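(* Let $d\mu = w(\theta)\frac{d\theta}{2\pi}+d\mu_s$ be a probability measure on the unit circle $\partial\mathbb{D}$ with infinite support ($d\mu_s$ being its singular part) and let $\{\alpha_n\}_{n=0}^\infty$ be its Verblunsky coefficients. Assume that $$\{\alpha_n\}_{n=0}^\infty\in\ell^p \cap GBV(A)$$ for a positive odd integer $p=2q+1$ and a finite set $A\subset \mathbb{R}$. Let $$S = \bigl\{e^{i \eta} \;\big|\; \eta \in (\underbrace{A+\dots+A}_{q\text{ times}}) - (\underbrace{A+\dots+A}_{q-1\text{ times}})\bigr\}$$ (with $S=\emptyset$ if $q=0$). Then (i) $\operatorname{supp} \mu_s \subset S$ and, in particular, $d\mu$ has no singular continuous part; (ii) $w(\theta)$ is continuous and strictly positive on $\partial\mathbb{D} \setminus S$.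
   Context: Verblunsky coefficients: a probability measure $\mu$ on $\partial\mathbb{D}$ of infinite support has orthonormal polynomials $\varphi_n(z)$, $\deg\varphi_n=n$ (positive leading coefficients), $\int\overline{\varphi_m}\varphi_n\,d\mu=\delta_{mn}$, and its Verblunsky coefficients $\alpha_n\in\mathbb{D}=\{|z|<1\}$ are the numbers for which the Szegő recursion $z\varphi_n(z)=\sqrt{1-|\alpha_n|^2}\,\varphi_{n+1}(z)+\bar\alpha_n\varphi_n^*(z)$ holds, where $\varphi_n^*(z)=z^n\overline{\varphi_n(1/\bar z)}$. Generalized bounded variation: a complex sequence $\{\beta_n\}_{n=N}^\infty$ has rotated bounded variation with phase $\phi\in\mathbb{R}$ if $\sum_{n=N}^\infty|e^{i\phi}\beta_{n+1}-\beta_n|<\infty$. For a finite set $A=\{\phi_1,\dots,\phi_L\}\subset\mathbb{R}$, $GBV(A)$ is the set of sequences $\{\alpha_n\}_{n=N}^\infty$ that can be written as $\alpha_n=\sum_{l=1}^L\beta_n^{(l)}$ where $\beta^{(l)}$ has rotated bounded variation with phase $\phi_l$. Conventions: $A+\dots+A$ ($k$ times) is the set of all sums $a_1+\dots+a_k$ with $a_i\in A$ (equal to $\{0\}$ when $k=0$); $X-Y=\{x-y: x\in X,y\in Y\}$. Points $\theta$ and $e^{i\theta}$ are identified. The density $w$ is defined up to almost everywhere equality; "continuous and strictly positive" means that it has a representative with this property on the given set. *)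

theory Defs
  imports "HOL-Probability.Probability" "HOL-Computational_Algebra.Polynomial"
begin

section \<open>Measures on the unit circle\<close>

text \<open>The point \<open>\<theta>\<close> is identified with \<open>cis \<theta>\<close>, so densities are functions of a point of the circle.\<close>

abbreviation unit_circle :: "complex set" where
  "unit_circle \<equiv> sphere 0 1"

abbreviation circle_borel :: "complex measure" where
  "circle_borel \<equiv> restrict_space borel unit_circle"

text \<open>The measure \<open>d\<theta> / 2\<pi>\<close>; \<^const>\<open>uniform_measure\<close> supplies the factor \<open>1 / 2\<pi>\<close>.\<close>

definition arc_measure :: "complex measure" where
  "arc_measure = distr (uniform_measure lborel {0..<2 * pi}) circle_borel cis"

text \<open>Topological support.\<close>

definition measure_support :: "'a::topological_space measure \<Rightarrow> 'a set" where
  "measure_support M = {x \<in> space M. \<forall>U. open U \<and> x \<in> U \<longrightarrow> emeasure M (U \<inter> space M) > 0}"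

definition mutually_singular :: "'a measure \<Rightarrow> 'a measure \<Rightarrow> bool" where
  "mutually_singular M N \<longleftrightarrow>
     (\<exists>E \<in> sets M \<inter> sets N. emeasure M E = 0 \<and> emeasure N (space N - E) = 0)"

text \<open>\<open>d\<mu> = w d\<theta>/2\<pi> + d\<mu>\<^sub>s\<close> with \<open>\<mu>\<^sub>s\<close> singular; here \<open>w\<close> is only determined almost everywhere.\<close>

definition lebesgue_decomposition ::
    "complex measure \<Rightarrow> (complex \<Rightarrow> real) \<Rightarrow> complex measure \<Rightarrow> bool" where
  "lebesgue_decomposition \<mu> w \<mu>s \<longleftrightarrow>
     w \<in> borel_measurable circle_borel \<and> (AE z in arc_measure. 0 \<le> w z) \<and>
     sets \<mu>s = sets circle_borel \<and> mutually_singular arc_measure \<mu>s \<and>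
     (\<forall>B \<in> sets circle_borel.
        emeasure \<mu> B = emeasure (density arc_measure (\<lambda>z. ennreal (w z))) B + emeasure \<mu>s B)"

text \<open>The restriction of a finite measure to the complement of its atoms. Applied to the
  singular part of \<open>\<mu>\<close>, this is the singular continuous part of \<open>\<mu>\<close>.\<close>

definition continuous_part :: "'a measure \<Rightarrow> 'a measure" where
  "continuous_part M = density M (indicator {x \<in> space M. emeasure M {x} = 0})"


section \<open>Verblunsky coefficients\<close>

definition orthonormal_polys :: "complex measure \<Rightarrow> (nat \<Rightarrow> complex poly) \<Rightarrow> bool" where
  "orthonormal_polys \<mu> \<phi> \<longleftrightarrow>
     (\<forall>n. degree (\<phi> n) = n \<and> lead_coeff (\<phi> n) \<in> \<real> \<and> Re (lead_coeff (\<phi> n)) > 0) \<and>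
     (\<forall>m n. (LINT z|\<mu>. cnj (poly (\<phi> m) z) * poly (\<phi> n) z) = (if m = n then 1 else 0))"

text \<open>\<open>\<phi>\<^sub>n\<^sup>*(z)\<close>. The formula is meant for \<open>z \<noteq> 0\<close>; since \<open>1 / 0 = 0\<close> it does not give the value at
  \<open>0\<close> of the polynomial \<open>\<phi>\<^sub>n\<^sup>*\<close>.\<close>

definition szego_dual :: "nat \<Rightarrow> complex poly \<Rightarrow> complex \<Rightarrow> complex" where
  "szego_dual n p z = z ^ n * cnj (poly p (1 / cnj z))"

text \<open>The recursion is an identity between polynomials, so requiring it for \<open>z \<noteq> 0\<close> loses nothing.\<close>

definition verblunsky_coeffs :: "complex measure \<Rightarrow> (nat \<Rightarrow> complex) \<Rightarrow> bool" where
  "verblunsky_coeffs \<mu> \<alpha> \<longleftrightarrow>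
     (\<forall>n. norm (\<alpha> n) < 1) \<and>
     (\<exists>\<phi>. orthonormal_polys \<mu> \<phi> \<and>
       (\<forall>n z. z \<noteq> 0 \<longrightarrow>
          z * poly (\<phi> n) z =
            complex_of_real (sqrt (1 - (norm (\<alpha> n))\<^sup>2)) * poly (\<phi> (Suc n)) z
            + cnj (\<alpha> n) * szego_dual n (\<phi> n) z))"


section \<open>Generalized bounded variation\<close>

text \<open>A sequence indexed by \<open>n \<ge> N\<close> is represented by a function on all of \<open>nat\<close> whose values below
  \<open>N\<close> are irrelevant.\<close>

definition rotated_bv :: "nat \<Rightarrow> real \<Rightarrow> (nat \<Rightarrow> complex) \<Rightarrow> bool" where
  "rotated_bv N \<phi> \<beta> \<longleftrightarrow> summable (\<lambda>n. norm (cis \<phi> * \<beta> (N + n + 1) - \<beta> (N + n)))"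

definition GBV :: "nat \<Rightarrow> real set \<Rightarrow> (nat \<Rightarrow> complex) set" where
  "GBV N A = {\<alpha>. \<exists>\<beta>. (\<forall>\<phi>\<in>A. rotated_bv N \<phi> (\<beta> \<phi>)) \<and> (\<forall>n\<ge>N. \<alpha> n = (\<Sum>\<phi>\<in>A. \<beta> \<phi> n))}"

definition ell :: "nat \<Rightarrow> (nat \<Rightarrow> complex) set" where
  "ell p = {\<alpha>. summable (\<lambda>n. norm (\<alpha> n) ^ p)}"


section \<open>The exceptional set\<close>

definition fold_sumset :: "nat \<Rightarrow> real set \<Rightarrow> real set" where
  "fold_sumset k A = {(\<Sum>i<k. a i) | a. \<forall>i<k. a i \<in> A}"

definition exceptional_set :: "nat \<Rightarrow> real set \<Rightarrow> complex set" where
  "exceptional_set q A =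
     (if q = 0 then {}
      else {cis (x - y) | x y. x \<in> fold_sumset q A \<and> y \<in> fold_sumset (q - 1) A})"

end

theory Submission
  imports Defs "HOL-Complex_Analysis.Cauchy_Integral_Formula"
begin

text \<open>The measures \<open>\<bar>\<phi>\<^sub>n\<bar>\<^sup>-\<^sup>2 d\<theta> / 2\<pi>\<close> have the same moments as \<open>\<mu>\<close> up to order \<open>n\<close> and so converge weakly
  to \<open>\<mu>\<close>. It therefore suffices that \<open>\<bar>\<phi>\<^sub>n\<bar>\<^sup>-\<^sup>2\<close> converges to a positive continuous function uniformly
  on compact subsets of the circle off the exceptional set \<open>S\<close>.

  On the ratio \<open>\<phi>\<^sub>n / \<phi>\<^sub>n\<^sup>*\<close> the Szego recursion acts by automorphisms of the disk. We look for an
  approximate orbit that tends to \<open>0\<close>, that is (after complex conjugation) for \<open>t\<^sub>n \<longlonglongrightarrow> 0\<close> with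
  \<open>t\<^sub>n - z t\<^sub>n\<^sub>+\<^sub>1 = z \<alpha>\<^sub>n - cnj \<alpha>\<^sub>n t\<^sub>n t\<^sub>n\<^sub>+\<^sub>1\<close> up to a summable error. Such \<open>t\<close> is the sum of
  \<open>u\<^sub>0, \<dots>, u\<^sub>q\<^sub>-\<^sub>1\<close>, where \<open>u\<^sub>j\<close> is a combination of products of \<open>j + 1\<close> components of \<open>\<alpha>\<close> and \<open>j\<close>
  conjugate components. Modulo summable sequences, \<open>1 - z T\<close> (with \<open>T\<close> the shift) acts on such a product
  as \<open>1 - z cnj w\<close>, \<open>w\<close> being its phase, and inverting it creates poles only at points of \<open>S\<close>. What is
  left has order \<open>2 q + 1 = p\<close> and is summable. Finally
  \<open>\<bar>\<phi>\<^sub>n\<^sup>* - t\<^sub>n \<phi>\<^sub>n\<bar>\<^sup>2 / (1 - \<bar>t\<^sub>n\<bar>\<^sup>2)\<close> would be constant for an exact orbit; so its logarithm has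
  summable increments, and it has a positive limit, which is also that of \<open>\<bar>\<phi>\<^sub>n\<bar>\<^sup>2\<close>.\<close>

section \<open>The normalized arc length measure\<close>

lemma cis_measurable_circle:
  "cis \<in> measurable (uniform_measure lborel {0..<2 * pi}) circle_borel"
proof -
  have "cis \<in> measurable borel circle_borel"
    by (rule measurable_restrict_space2) (auto intro!: borel_measurable_continuous_onI continuous_intros)
  thus ?thesis
    unfolding measurable_cong_sets[OF sets_uniform_measure refl] measurable_cong_sets[OF sets_lborel refl] .
qed

lemma sets_arc_measure [simp, measurable_cong]: "sets arc_measure = sets circle_borel"
  by (simp add: arc_measure_def)

lemma space_arc_measure [simp]: "space arc_measure = unit_circle"
  by (simp add: arc_measure_def space_restrict_space)

lemma prob_space_arc_measure: "prob_space arc_measure"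
  unfolding arc_measure_def
  by (rule prob_space.prob_space_distr[OF prob_space_uniform_measure cis_measurable_circle]) auto

interpretation arc: prob_space arc_measure
  by (rule prob_space_arc_measure)

lemma borel_measurable_circle_continuous:
  fixes f :: "complex \<Rightarrow> 'a::topological_space"
  assumes "continuous_on unit_circle f"
  shows "f \<in> borel_measurable circle_borel"
  using borel_measurable_continuous_on_restrict[OF assms] .

lemma integrable_circle_continuous:
  fixes f :: "complex \<Rightarrow> 'a::{banach, second_countable_topology}"
  assumes "finite_measure M" "sets M = sets circle_borel" "continuous_on unit_circle f"
  shows "integrable M f"
proof -
  interpret finite_measure M by fact
  have "compact (f ` unit_circle)"
    using assms(3) by (intro compact_continuous_image) auto
  then obtain B where B: "\<And>z. z \<in> unit_circle \<Longrightarrow> norm (f z) \<le> B"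
    by (meson bounded_iff compact_imp_bounded imageI)
  have sp: "space M = unit_circle"
    using sets_eq_imp_space_eq[OF assms(2)] by (simp add: space_restrict_space)
  show ?thesis
  proof (rule integrable_const_bound[of _ B])
    show "AE x in M. norm (f x) \<le> B"
      using B sp by auto
    show "f \<in> borel_measurable M"
      using borel_measurable_circle_continuous[OF assms(3)]
      unfolding measurable_cong_sets[OF assms(2) refl] .
  qed
qed

lemma integral_arc_measure:
  fixes f :: "complex \<Rightarrow> complex"
  assumes f: "continuous_on unit_circle f"
  shows "(LINT z|arc_measure. f z) = integral {0..2 * pi} (\<lambda>t. f (cis t)) / (2 * pi)"
proof -
  let ?U = "uniform_measure lborel {0..<2 * pi}"
  have fm: "f \<in> borel_measurable circle_borel"
    by (rule borel_measurable_circle_continuous[OF f])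
  have cf: "continuous_on S (\<lambda>t. f (cis t))" for S
    by (rule continuous_on_compose2[OF f]) (auto intro!: continuous_intros)
  have cm: "(\<lambda>t. f (cis t)) \<in> borel_measurable borel"
    by (rule borel_measurable_continuous_onI[OF cf])
  have U: "?U = density lborel (\<lambda>x. ennreal (indicator {0..<2 * pi} x / (2 * pi)))"
  proof -
    have "indicator {0..<2 * pi} x / emeasure lborel {0..<2 * pi} =
        ennreal (indicator {0..<2 * pi} x / (2 * pi))" for x
      using divide_ennreal[of 1 "2 * pi"] by (cases "x \<in> {0..<2 * pi}") auto
    thus ?thesis unfolding uniform_measure_def by simp
  qed
  have "(LINT z|arc_measure. f z) = (LINT t|?U. f (cis t))"
    unfolding arc_measure_def by (rule integral_distr[OF cis_measurable_circle fm])
  also have "\<dots> = (LINT t|lborel. (indicator {0..<2 * pi} t / (2 * pi)) *\<^sub>R f (cis t))"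
    unfolding U by (rule integral_density) (use cm in auto)
  \<comment> \<open>Replaces the half-open interval of \<open>arc_measure\<close> by the closed one
    of the Henstock-Kurzweil integral; they differ by one point, a null set.\<close>
  also have "\<dots> = (LINT t|lborel. (1 / (2 * pi)) *\<^sub>R (indicator {0..2 * pi} t *\<^sub>R f (cis t)))"
  proof (rule integral_cong_AE)
    have "AE t in lborel. t \<noteq> 2 * pi"
      by (rule AE_lborel_singleton)
    thus "AE t in lborel. (indicator {0..<2 * pi} t / (2 * pi)) *\<^sub>R f (cis t) =
        (1 / (2 * pi)) *\<^sub>R (indicator {0..2 * pi} t *\<^sub>R f (cis t))"
      by eventually_elim (auto simp: indicator_def)
  qed (use cm in auto)
  also have "\<dots> = (1 / (2 * pi)) *\<^sub>R set_lebesgue_integral lborel {0..2 * pi} (\<lambda>t. f (cis t))"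
    by (simp only: set_lebesgue_integral_def integral_scaleR_right)
  also have "set_lebesgue_integral lborel {0..2 * pi} (\<lambda>t. f (cis t)) = integral {0..2 * pi} (\<lambda>t. f (cis t))"
    by (rule set_borel_integral_eq_integral(2))
       (auto intro!: borel_integrable_compact cf simp: set_integrable_def)
  finally show ?thesis
    by (simp add: scaleR_conv_of_real)
qed

text \<open>Cauchy's formula at the centre, since dz / (2 pi i z) is normalized arc length on the
  circle. It evaluates integrals that have the nonvanishing \<open>\<psi> n\<close> in the
  denominator.\<close>

lemma arc_measure_mean_value:
  assumes "f holomorphic_on cball 0 1"
  shows "(LINT z|arc_measure. f z) = f 0"
proof -
  have "((\<lambda>u. f u / (u - 0)) has_contour_integral (2 * of_real pi * \<i> * f 0)) (circlepath 0 1)"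
    by (rule Cauchy_integral_circlepath_simple) (use assms in auto)
  hence "((\<lambda>t. f (0 + 1 * cis t) / (0 + 1 * cis t - 0) * 1 * \<i> * cis t) has_integral
      (2 * of_real pi * \<i> * f 0)) {0..2 * pi}"
    unfolding circlepath_def using has_contour_integral_part_circlepath_iff[of 0 "2 * pi"
       "\<lambda>u. f u / (u - 0)" "2 * of_real pi * \<i> * f 0" 0 1] by simp
  hence "((\<lambda>t. \<i> * f (cis t)) has_integral (\<i> * (2 * of_real pi * f 0))) {0..2 * pi}"
    by (simp add: mult_ac)
  from has_integral_mult_right[OF this, of "-\<i>"]
  have "integral {0..2 * pi} (\<lambda>t. f (cis t)) = 2 * of_real pi * f 0"
    by (intro integral_unique) (simp add: mult.assoc[symmetric])
  moreover have "continuous_on unit_circle f"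
    using holomorphic_on_imp_continuous_on[OF assms] by (rule continuous_on_subset) auto
  ultimately show ?thesis
    by (simp add: integral_arc_measure)
qed

text \<open>\<open>cis\<close> is injective on \<open>{0..<2 * pi}\<close>, so a point has a finite,
  hence Lebesgue null, preimage.\<close>

lemma arc_measure_null_finite:
  assumes "finite S" "S \<subseteq> unit_circle"
  shows "emeasure arc_measure S = 0"
proof -
  have sing: "{z} \<in> sets circle_borel" if "z \<in> unit_circle" for z :: complex
    using that by (subst sets_restrict_space_iff) auto
  have 1: "emeasure arc_measure {z} = 0" if z: "z \<in> unit_circle" for z
  proof -
    have fin: "finite (cis -` {z} \<inter> {0..<2 * pi})"
    proof (rule finite_vimage_IntI)
      have "cis x = cis y \<Longrightarrow> x = y" if "x \<in> {0..<2 * pi}" "y \<in> {0..<2 * pi}" for x y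
      proof -
        assume "cis x = cis y"
        hence "sin x = sin y \<and> cos x = cos y" by (metis cis.sel)
        then obtain n :: int where n: "x = y + 2 * pi * n" using sin_cos_eq_iff by metis
        have "\<bar>x - y\<bar> < 2 * pi" using that by auto
        hence "\<bar>2 * pi * n\<bar> < 2 * pi" using n by simp
        hence "\<bar>real_of_int n\<bar> < 1" by (simp add: abs_mult)
        hence "n = 0" by linarith
        thus "x = y" using n by simp
      qed
      thus "inj_on cis {0..<2 * pi}" by (auto simp: inj_on_def)
    qed simp
    have "{z} \<in> sets circle_borel" using z by (rule sing)
    hence "emeasure arc_measure {z} = emeasure (uniform_measure lborel {0..<2 * pi}) (cis -` {z})"
      unfolding arc_measure_def by (subst emeasure_distr[OF cis_measurable_circle]) auto
    also have "\<dots> = emeasure lborel ({0..<2 * pi} \<inter> cis -` {z}) / emeasure lborel {0..<2 * pi}"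
    proof (rule emeasure_uniform_measure)
      have "closed (cis -` {z})"
        by (rule closed_vimage) (simp_all add: continuous_on_cis continuous_on_id)
      thus "cis -` {z} \<in> sets lborel" by auto
    qed auto
    also have "emeasure lborel ({0..<2 * pi} \<inter> cis -` {z}) = 0"
      by (rule emeasure_lborel_countable) (use countable_finite[OF fin] in \<open>simp add: Int_commute\<close>)
    finally show ?thesis by simp
  qed
  have "emeasure arc_measure S = (\<Sum>z\<in>S. emeasure arc_measure {z})"
    by (rule emeasure_eq_sum_singleton) (use assms sing in auto)
  also have "\<dots> = 0"
    using 1 assms by (intro sum.neutral) auto
  finally show ?thesis .
qed


section \<open>The Szego recursion and Bernstein-Szego measures\<close>

lemma circle_mult_cnj: "z \<in> unit_circle \<Longrightarrow> z * cnj z = 1"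
  by (simp add: complex_mult_cnj cmod_def)

lemma circle_in_sets: "unit_circle \<in> sets circle_borel"
  using sets.top[of circle_borel] by (simp add: space_restrict_space)

text \<open>Only the recursion and the degrees are assumed, no measure: the Bernstein-Szego measures
  and the convergence of their weights are derived from these alone.\<close>

locale szego_system =
  fixes \<alpha> :: "nat \<Rightarrow> complex" and \<phi> :: "nat \<Rightarrow> complex poly"
  assumes norm_\<alpha>: "norm (\<alpha> n) < 1"
    and degree_\<phi>: "degree (\<phi> n) = n"
    and \<phi>_nonzero: "\<phi> n \<noteq> 0"
    and szego_recursion: "z \<noteq> 0 \<Longrightarrow> z * poly (\<phi> n) z =
          complex_of_real (sqrt (1 - (norm (\<alpha> n))\<^sup>2)) * poly (\<phi> (Suc n)) z
          + cnj (\<alpha> n) * szego_dual n (\<phi> n) z"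
begin

text \<open>The polynomial \<open>\<phi>\<^sub>n\<^sup>*\<close> itself, which unlike
  \<open>szego_dual\<close> also has the right value at \<open>0\<close>: the conjugate of the
  leading coefficient of \<open>\<phi> n\<close>.\<close>

definition \<psi> :: "nat \<Rightarrow> complex poly" where
  "\<psi> n = reflect_poly (map_poly cnj (\<phi> n))"

definition \<rho> :: "nat \<Rightarrow> real" where
  "\<rho> n = sqrt (1 - (norm (\<alpha> n))\<^sup>2)"

lemma \<rho>_pos: "\<rho> n > 0"
  using norm_\<alpha>[of n] by (simp add: \<rho>_def power_less_one_iff abs_square_less_1)

lemma \<rho>_squared: "(\<rho> n)\<^sup>2 = 1 - (norm (\<alpha> n))\<^sup>2"
  using norm_\<alpha>[of n] by (simp add: \<rho>_def power_le_one)

lemma poly_\<psi>: "z \<noteq> 0 \<Longrightarrow> poly (\<psi> n) z = z ^ n * cnj (poly (\<phi> n) (1 / cnj z))"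
  by (simp add: \<psi>_def poly_reflect_poly_nz degree_map_poly degree_\<phi> inverse_eq_divide)

lemma poly_\<psi>_0: "poly (\<psi> n) 0 \<noteq> 0"
  using \<phi>_nonzero[of n] by (simp add: \<psi>_def coeff_map_poly degree_map_poly)

lemma recursion_\<phi>:
  assumes "z \<noteq> 0"
  shows "z * poly (\<phi> n) z = \<rho> n * poly (\<phi> (Suc n)) z + cnj (\<alpha> n) * poly (\<psi> n) z"
  using szego_recursion[OF assms, of n] poly_\<psi>[OF assms, of n] by (simp add: szego_dual_def \<rho>_def)

text \<open>Conjugates the recursion at the reflected point \<open>1 / cnj z\<close> and multiplies
  by \<open>z ^ Suc n\<close>.\<close>

lemma recursion_\<psi>:
  assumes z: "z \<noteq> 0"
  shows "poly (\<psi> n) z = \<rho> n * poly (\<psi> (Suc n)) z + \<alpha> n * z * poly (\<phi> n) z"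
proof -
  let ?w = "1 / cnj z"
  have w: "?w \<noteq> 0" "1 / cnj ?w = z" "cnj ?w = 1 / z" using z by auto
  have "cnj (?w * poly (\<phi> n) ?w) * z ^ Suc n =
      cnj (\<rho> n * poly (\<phi> (Suc n)) ?w + cnj (\<alpha> n) * poly (\<psi> n) ?w) * z ^ Suc n"
    using recursion_\<phi>[OF w(1)] by simp
  also have "\<dots> = \<rho> n * (z ^ Suc n * cnj (poly (\<phi> (Suc n)) ?w)) +
      \<alpha> n * z ^ Suc n * cnj (poly (\<psi> n) ?w)"
    by (simp add: algebra_simps)
  also have "cnj (poly (\<psi> n) ?w) = (1 / z) ^ n * poly (\<phi> n) z"
    unfolding poly_\<psi>[OF w(1)] w(2) by simp
  also have "z ^ Suc n * cnj (poly (\<phi> (Suc n)) ?w) = poly (\<psi> (Suc n)) z"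
    by (rule poly_\<psi>[OF z, symmetric])
  also have "cnj (?w * poly (\<phi> n) ?w) * z ^ Suc n = poly (\<psi> n) z"
    using z by (simp add: poly_\<psi>[OF z])
  finally show ?thesis
    using z by (simp add: power_divide mult_ac)
qed

text \<open>In the closed disk a step acts on the ratio of \<open>\<phi>\<close> to
  \<open>\<psi>\<close> by multiplication by \<open>z\<close> and an automorphism of the disk, so
  its modulus stays at most 1. Nonvanishing of \<open>\<psi>\<close> joins the induction, as it
  rests on this bound and on \<open>norm (\<alpha> n) < 1\<close>.\<close>

lemma norm_\<phi>_le_\<psi>_nonzero:
  assumes z: "z \<noteq> 0" "norm z \<le> 1"
  shows "norm (poly (\<phi> n) z) \<le> norm (poly (\<psi> n) z) \<and> poly (\<psi> n) z \<noteq> 0"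
proof (induction n)
  case 0
  obtain c where c: "\<phi> 0 = [:c:]" using degree_0_id[OF degree_\<phi>[of 0]] by metis
  hence "c \<noteq> 0" using \<phi>_nonzero[of 0] by auto
  thus ?case using c poly_\<psi>[OF z(1), of 0] by simp
next
  case (Suc n)
  let ?a = "\<alpha> n" and ?f = "poly (\<phi> n) z" and ?g = "poly (\<psi> n) z"
  let ?F = "poly (\<phi> (Suc n)) z" and ?G = "poly (\<psi> (Suc n)) z"
  have F: "\<rho> n * ?F = z * ?f - cnj ?a * ?g" using recursion_\<phi>[OF z(1), of n] by simp
  have G: "\<rho> n * ?G = ?g - ?a * (z * ?f)" using recursion_\<psi>[OF z(1), of n] by simp
  have zf: "norm (z * ?f) \<le> norm ?g"
    using Suc z mult_mono[of "norm z" 1 "norm ?f" "norm ?g"] by (simp add: norm_mult)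
  \<comment> \<open>The indefinite form \<open>(norm v)\<^sup>2 - (norm u)\<^sup>2\<close> is
    preserved up to a positive factor.\<close>
  have key: "(norm (v - a * u))\<^sup>2 - (norm (u - cnj a * v))\<^sup>2 = (1 - (norm a)\<^sup>2) * ((norm v)\<^sup>2 - (norm u)\<^sup>2)"
    for a u v :: complex
    unfolding cmod_power2 by (simp add: algebra_simps power2_eq_square)
  have "(norm (\<rho> n * ?G))\<^sup>2 - (norm (\<rho> n * ?F))\<^sup>2 \<ge> 0"
    unfolding F G key using zf norm_\<alpha>[of n]
    by (intro mult_nonneg_nonneg) (auto simp: power_le_one)
  hence "norm (\<rho> n * ?F) \<le> norm (\<rho> n * ?G)"
    by (meson diff_ge_0_iff_ge norm_ge_zero power2_le_imp_le)
  moreover have "norm (?a * (z * ?f)) < norm ?g"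
  proof -
    have "norm (?a * (z * ?f)) \<le> norm ?a * norm ?g"
      using zf by (simp add: norm_mult[of ?a] mult_left_mono)
    also have "\<dots> < 1 * norm ?g" using Suc norm_\<alpha>[of n] by (intro mult_strict_right_mono) auto
    finally show ?thesis by simp
  qed
  hence "\<rho> n * ?G \<noteq> 0" unfolding G by auto
  ultimately show ?case using \<rho>_pos[of n] by (simp add: norm_mult)
qed

lemma \<psi>_nonzero: "norm z \<le> 1 \<Longrightarrow> poly (\<psi> n) z \<noteq> 0"
  using norm_\<phi>_le_\<psi>_nonzero[of z n] poly_\<psi>_0[of n] by (cases "z = 0") auto

lemma poly_\<psi>_circle:
  assumes "z \<in> unit_circle"
  shows "poly (\<psi> n) z = z ^ n * cnj (poly (\<phi> n) z)"
proof -
  have "z \<noteq> 0" using assms by auto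
  moreover have "1 / cnj z = z" using circle_mult_cnj[OF assms] calculation by (simp add: divide_simps)
  ultimately show ?thesis by (simp add: poly_\<psi>)
qed

lemma norm_\<psi>_circle: "z \<in> unit_circle \<Longrightarrow> norm (poly (\<psi> n) z) = norm (poly (\<phi> n) z)"
  by (simp add: poly_\<psi>_circle norm_mult norm_power)

lemma \<phi>_nonzero_circle: "z \<in> unit_circle \<Longrightarrow> poly (\<phi> n) z \<noteq> 0"
  using \<psi>_nonzero[of z n] norm_\<psi>_circle[of z n] by auto

text \<open>Eliminates \<open>\<psi> n\<close> from the two recursions and cancels one factor
  \<open>\<rho> n\<close>. This runs the recursion downwards, for the descent in
  \<open>bs_measure_orthogonal\<close>.\<close>

lemma inverse_recursion:
  assumes z: "z \<noteq> 0"
  shows "\<rho> n * (z * poly (\<phi> n) z) = poly (\<phi> (Suc n)) z + cnj (\<alpha> n) * poly (\<psi> (Suc n)) z"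
proof -
  let ?f = "poly (\<phi> n) z" 
  have r2: "of_real (\<rho> n) * of_real (\<rho> n) = 1 - cnj (\<alpha> n) * \<alpha> n"
    using \<rho>_squared[of n] complex_norm_square[of "\<alpha> n"]
    by (metis (no_types, opaque_lifting) mult.commute of_real_1 of_real_diff of_real_mult power2_eq_square)
  have "z * ?f = \<rho> n * poly (\<phi> (Suc n)) z +
      cnj (\<alpha> n) * (\<rho> n * poly (\<psi> (Suc n)) z + \<alpha> n * z * ?f)"
    using recursion_\<phi>[OF z, of n] recursion_\<psi>[OF z, of n] by simp
  hence "(1 - cnj (\<alpha> n) * \<alpha> n) * (z * ?f) = \<rho> n * (poly (\<phi> (Suc n)) z + cnj (\<alpha> n) * poly (\<psi> (Suc n)) z)"
    by algebra
  hence "of_real (\<rho> n) * (\<rho> n * (z * ?f)) = \<rho> n * (poly (\<phi> (Suc n)) z + cnj (\<alpha> n) * poly (\<psi> (Suc n)) z)"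
    unfolding r2[symmetric] by (simp add: mult_ac)
  thus ?thesis using \<rho>_pos[of n] by simp
qed

section \<open>Bernstein-Szego measures and their orthogonality relations\<close>

definition bs_measure :: "nat \<Rightarrow> complex measure" where
  "bs_measure n = density arc_measure (\<lambda>z. ennreal (1 / (norm (poly (\<phi> n) z))\<^sup>2))"

lemma continuous_weight: "continuous_on unit_circle (\<lambda>z. 1 / (norm (poly (\<phi> n) z))\<^sup>2)"
  using \<phi>_nonzero_circle by (intro continuous_intros) auto

lemma measurable_weight: "(\<lambda>z. 1 / (norm (poly (\<phi> n) z))\<^sup>2) \<in> borel_measurable arc_measure"
  unfolding measurable_cong_sets[OF sets_arc_measure refl]
  by (rule borel_measurable_circle_continuous[OF continuous_weight])

lemma sets_bs_measure: "sets (bs_measure n) = sets circle_borel"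
  by (simp add: bs_measure_def)

lemma space_bs_measure: "space (bs_measure n) = unit_circle"
  by (simp add: bs_measure_def)

lemma finite_measure_bs_measure: "finite_measure (bs_measure n)"
proof (rule finite_measureI)
  have "emeasure (bs_measure n) (space (bs_measure n)) =
      (\<integral>\<^sup>+z. ennreal (1 / (norm (poly (\<phi> n) z))\<^sup>2) \<partial>arc_measure)"
    unfolding bs_measure_def using measurable_weight
    by (subst emeasure_density) (auto intro!: nn_integral_cong simp: indicator_def circle_in_sets)
  also have "\<dots> = ennreal (LINT z|arc_measure. 1 / (norm (poly (\<phi> n) z))\<^sup>2)"
    by (intro nn_integral_eq_integral integrable_circle_continuous continuous_weight
        arc.finite_measure_axioms) auto
  finally show "emeasure (bs_measure n) (space (bs_measure n)) \<noteq> \<infinity>" by simp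
qed

lemma integral_bs_measure:
  fixes f :: "complex \<Rightarrow> 'a::{banach, second_countable_topology}"
  assumes "continuous_on unit_circle f"
  shows "(LINT z|bs_measure n. f z) = (LINT z|arc_measure. (1 / (norm (poly (\<phi> n) z))\<^sup>2) *\<^sub>R f z)"
  unfolding bs_measure_def
proof (rule integral_density[OF _ measurable_weight])
  show "f \<in> borel_measurable arc_measure"
    unfolding measurable_cong_sets[OF sets_arc_measure refl]
    by (rule borel_measurable_circle_continuous[OF assms])
qed auto

text \<open>Downward induction from \<open>k = n\<close>, where the integrand on the circle is
  \<open>z ^ (n - j) / poly (\<psi> n) z\<close>, holomorphic on the closed disk and zero at the
  origin. In the step, \<open>inverse_recursion\<close> leads to \<open>\<phi> (Suc k)\<close>
  tested against \<open>z ^ Suc j\<close> and, after conjugation, against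
  \<open>z ^ (k - j)\<close>; both exponents are below \<open>Suc k\<close>.\<close>

lemma bs_measure_orthogonal:
  assumes "k \<le> n" "j < k"
  shows "(LINT z|bs_measure n. cnj (z ^ j) * poly (\<phi> k) z) = 0"
  using assms
proof (induction arbitrary: j rule: inc_induct)
  case base
  have "(LINT z|bs_measure n. cnj (z ^ j) * poly (\<phi> n) z) =
      (LINT z|arc_measure. (1 / (norm (poly (\<phi> n) z))\<^sup>2) *\<^sub>R (cnj (z ^ j) * poly (\<phi> n) z))"
    by (rule integral_bs_measure) (intro continuous_intros)
  also have "\<dots> = (LINT z|arc_measure. z ^ (n - j) / poly (\<psi> n) z)"
  proof (rule Bochner_Integration.integral_cong[OF refl])
    fix z assume "z \<in> space arc_measure"
    hence z: "z \<in> unit_circle" by simp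
    have nz: "poly (\<phi> n) z \<noteq> 0" "z \<noteq> 0" using \<phi>_nonzero_circle[OF z] z by auto
    have "z ^ n * cnj (z ^ j) = z ^ (n - j) * (z * cnj z) ^ j"
      using base by (simp add: power_mult_distrib power_add[symmetric] mult.assoc[symmetric])
    hence zz: "z ^ n * cnj (z ^ j) = z ^ (n - j)" using circle_mult_cnj[OF z] by simp
    have "(1 / (norm (poly (\<phi> n) z))\<^sup>2) *\<^sub>R (cnj (z ^ j) * poly (\<phi> n) z) =
        cnj (z ^ j) / cnj (poly (\<phi> n) z)"
      using nz complex_norm_square[of "poly (\<phi> n) z"] by (simp add: scaleR_conv_of_real divide_simps)
    also have "\<dots> = (z ^ n * cnj (z ^ j)) / (z ^ n * cnj (poly (\<phi> n) z))"
      using nz by simp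
    finally show "(1 / (norm (poly (\<phi> n) z))\<^sup>2) *\<^sub>R (cnj (z ^ j) * poly (\<phi> n) z) =
        z ^ (n - j) / poly (\<psi> n) z"
      unfolding zz poly_\<psi>_circle[OF z] .
  qed
  also have "\<dots> = 0 ^ (n - j) / poly (\<psi> n) 0"
    by (rule arc_measure_mean_value) (use \<psi>_nonzero in \<open>auto intro!: holomorphic_intros\<close>)
  also have "\<dots> = 0" using base by simp
  finally show ?case .
next
  case (step k)
  let ?L = "\<lambda>f. (LINT z|bs_measure n. f z) :: complex"
  have int: "integrable (bs_measure n) f" if "continuous_on unit_circle f" for f :: "complex \<Rightarrow> complex"
    by (rule integrable_circle_continuous[OF finite_measure_bs_measure sets_bs_measure that])
  have "\<rho> k * ?L (\<lambda>z. cnj (z ^ j) * poly (\<phi> k) z) = ?L (\<lambda>z. \<rho> k * (cnj (z ^ j) * poly (\<phi> k) z))"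
    by simp
  also have "\<dots> = ?L (\<lambda>z. cnj (z ^ Suc j) * poly (\<phi> (Suc k)) z +
      cnj (\<alpha> k) * cnj (cnj (z ^ (k - j)) * poly (\<phi> (Suc k)) z))"
  proof (rule Bochner_Integration.integral_cong[OF refl])
    fix z assume "z \<in> space (bs_measure n)"
    hence z: "z \<in> unit_circle" by (simp add: space_bs_measure)
    have nz: "z \<noteq> 0" using z by auto
    \<comment> \<open>Inserting \<open>z * cnj z = 1\<close> produces the factor \<open>z\<close>
      that occurs in \<open>inverse_recursion\<close>.\<close>
    have "\<rho> k * (cnj (z ^ j) * poly (\<phi> k) z) = (z * cnj z) * cnj (z ^ j) * (\<rho> k * poly (\<phi> k) z)"
      using circle_mult_cnj[OF z] by (simp add: mult_ac)
    also have "\<dots> = cnj (z ^ Suc j) * (\<rho> k * (z * poly (\<phi> k) z))"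
      by (simp add: mult_ac)
    also have "\<dots> = cnj (z ^ Suc j) * poly (\<phi> (Suc k)) z +
        cnj (\<alpha> k) * (z ^ Suc k * cnj (z ^ Suc j) * cnj (poly (\<phi> (Suc k)) z))"
      unfolding inverse_recursion[OF nz] poly_\<psi>_circle[OF z] by (simp add: algebra_simps)
    also have "z ^ Suc k * cnj (z ^ Suc j) = z ^ (k - j) * (z * cnj z) ^ Suc j"
      using step by (simp only: complex_cnj_power power_mult_distrib power_add[symmetric] mult.assoc[symmetric]) simp
    also have "\<dots> = z ^ (k - j)" using circle_mult_cnj[OF z] by simp
    finally show "\<rho> k * (cnj (z ^ j) * poly (\<phi> k) z) = cnj (z ^ Suc j) * poly (\<phi> (Suc k)) z +
      cnj (\<alpha> k) * cnj (cnj (z ^ (k - j)) * poly (\<phi> (Suc k)) z)" by simp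
  qed
  also have "\<dots> = ?L (\<lambda>z. cnj (z ^ Suc j) * poly (\<phi> (Suc k)) z) +
      cnj (\<alpha> k) * cnj (?L (\<lambda>z. cnj (z ^ (k - j)) * poly (\<phi> (Suc k)) z))"
    by (subst Bochner_Integration.integral_add)
       (auto intro!: int continuous_intros simp del: complex_cnj_mult complex_cnj_power power_Suc)
  also have "\<dots> = 0"
    using step.IH[of "Suc j"] step.IH[of "k - j"] step.prems step.hyps by simp
  finally show ?case using \<rho>_pos[of k] by simp
qed

text \<open>The weight cancels against the integrand. The value is used to fix the total mass of
  \<open>bs_measure n\<close>.\<close>

lemma bs_measure_norm: "(LINT z|bs_measure n. (norm (poly (\<phi> n) z))\<^sup>2) = 1"
proof -
  have "(LINT z|bs_measure n. (norm (poly (\<phi> n) z))\<^sup>2) =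
      (LINT z|arc_measure. (1 / (norm (poly (\<phi> n) z))\<^sup>2) *\<^sub>R ((norm (poly (\<phi> n) z))\<^sup>2))"
    by (rule integral_bs_measure) (intro continuous_intros)
  also have "\<dots> = (LINT z|arc_measure. 1)"
    by (rule Bochner_Integration.integral_cong[OF refl]) (use \<phi>_nonzero_circle in auto)
  finally show ?thesis using arc.prob_space by simp
qed

end


section \<open>Weak convergence of the Bernstein-Szego measures\<close>

text \<open>Laurent polynomials with exponents from \<open>- N\<close> to \<open>N\<close>, cleared
  of negative powers. Agreement is asked only on the circle, where \<open>cnj z\<close> is
  \<open>1 / z\<close>.\<close>

definition trig_poly :: "nat \<Rightarrow> (complex \<Rightarrow> complex) \<Rightarrow> bool" where
  "trig_poly N f \<longleftrightarrow> (\<exists>p. degree p \<le> 2 * N \<and> (\<forall>z\<in>unit_circle. f z = poly p z / z ^ N))"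

lemma trig_poly_const: "trig_poly 0 (\<lambda>z. c)"
  unfolding trig_poly_def by (intro exI[of _ "[:c:]"]) auto

lemma trig_poly_raise:
  assumes "trig_poly N f" "N \<le> M"
  shows "trig_poly M f"
proof -
  from assms obtain p where p: "degree p \<le> 2 * N" "\<And>z. z \<in> unit_circle \<Longrightarrow> f z = poly p z / z ^ N"
    by (auto simp: trig_poly_def)
  have "degree (p * monom 1 (M - N)) \<le> 2 * M"
    using degree_mult_le[of p "monom 1 (M - N)"] p(1) assms(2) by (simp add: degree_monom_eq)
  moreover have "f z = poly (p * monom 1 (M - N)) z / z ^ M" if z: "z \<in> unit_circle" for z
  proof -
    have "z \<noteq> 0" using z by auto
    thus ?thesis using assms(2) by (simp add: p(2)[OF z] poly_monom power_diff)
  qed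
  ultimately show ?thesis unfolding trig_poly_def by blast
qed

lemma trig_poly_add:
  assumes "trig_poly N f" "trig_poly N g"
  shows "trig_poly N (\<lambda>z. f z + g z)"
proof -
  from assms obtain p q where p: "degree p \<le> 2 * N" "\<And>z. z \<in> unit_circle \<Longrightarrow> f z = poly p z / z ^ N"
    and q: "degree q \<le> 2 * N" "\<And>z. z \<in> unit_circle \<Longrightarrow> g z = poly q z / z ^ N"
    by (auto simp: trig_poly_def)
  show ?thesis unfolding trig_poly_def
    by (intro exI[of _ "p + q"]) (auto simp: p(2) q(2) add_divide_distrib intro: degree_add_le p(1) q(1))
qed

lemma trig_poly_mult:
  assumes "trig_poly N f" "trig_poly M g"
  shows "trig_poly (N + M) (\<lambda>z. f z * g z)"
proof -
  from assms obtain p q where p: "degree p \<le> 2 * N" "\<And>z. z \<in> unit_circle \<Longrightarrow> f z = poly p z / z ^ N"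
    and q: "degree q \<le> 2 * M" "\<And>z. z \<in> unit_circle \<Longrightarrow> g z = poly q z / z ^ M"
    by (auto simp: trig_poly_def)
  have "degree (p * q) \<le> 2 * (N + M)" using degree_mult_le[of p q] p(1) q(1) by simp
  thus ?thesis unfolding trig_poly_def
    by (intro exI[of _ "p * q"]) (auto simp: p(2) q(2) power_add)
qed

text \<open>Stone-Weierstrass provides real polynomial functions of the plane. On the circle they
  become trigonometric, because a real-linear functional is a combination of \<open>z\<close> and
  \<open>cnj z\<close>.\<close>

lemma trig_poly_polynomial_function:
  assumes "real_polynomial_function g"
  shows "\<exists>N. trig_poly N (\<lambda>z. complex_of_real (g z))"
  using assms
proof induction
  case (linear f)
  interpret f: bounded_linear f by fact
  \<comment> \<open>Chosen so that \<open>f z\<close> is twice the real part of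
    \<open>c * z\<close>: \<open>c\<close> is half of \<open>f 1 - \<i> * f \<i>\<close>.\<close>
  define c where "c = Complex (f 1 / 2) (- f \<i> / 2)"
  have f: "complex_of_real (f z) = c * z + cnj c * cnj z" for z
  proof -
    have "z = Re z *\<^sub>R 1 + Im z *\<^sub>R \<i>" by (simp add: complex_eq_iff)
    hence "f z = Re z * f 1 + Im z * f \<i>"
      using f.add f.scaleR by (metis real_scaleR_def)
    thus ?thesis by (simp add: c_def complex_eq_iff)
  qed
  have "complex_of_real (f z) = poly [:cnj c, 0, c:] z / z ^ 1" if z: "z \<in> unit_circle" for z
  proof -
    have "z \<noteq> 0" using z by auto
    hence "cnj z = 1 / z" using circle_mult_cnj[OF z] by (simp add: field_simps)
    thus ?thesis unfolding f using \<open>z \<noteq> 0\<close> by (simp add: field_simps)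
  qed
  hence "trig_poly 1 (\<lambda>z. complex_of_real (f z))"
    unfolding trig_poly_def by (intro exI[of _ "[:cnj c, 0, c:]"]) (auto simp: degree_pCons_le)
  thus ?case by blast
next
  case (const c)
  show ?case using trig_poly_const by blast
next
  case (add f g)
  then obtain N M where "trig_poly N (\<lambda>z. complex_of_real (f z))" "trig_poly M (\<lambda>z. complex_of_real (g z))"
    by blast
  hence "trig_poly (max N M) (\<lambda>z. complex_of_real (f z) + complex_of_real (g z))"
    by (intro trig_poly_add) (auto intro: trig_poly_raise)
  thus ?case by auto
next
  case (mult f g)
  then obtain N M where "trig_poly N (\<lambda>z. complex_of_real (f z))" "trig_poly M (\<lambda>z. complex_of_real (g z))"
    by blast
  from trig_poly_mult[OF this] show ?case by auto
qed

section \<open>Integrals of trigonometric polynomials and moments\<close>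

lemma poly_altdef_le:
  fixes p :: "'a::comm_semiring_1 poly"
  assumes "degree p \<le> n"
  shows "poly p x = (\<Sum>i\<le>n. coeff p i * x ^ i)"
  unfolding poly_altdef using assms
  by (intro sum.mono_neutral_left) (auto simp: coeff_eq_0)

text \<open>On the circle the conjugate of \<open>poly p z\<close> is the polynomial with reversed
  and conjugated coefficients, divided by \<open>z ^ n\<close>.\<close>

lemma trig_poly_norm_square:
  assumes "degree p \<le> n"
  shows "trig_poly n (\<lambda>z. complex_of_real ((norm (poly p z))\<^sup>2))"
proof -
  let ?q = "\<Sum>i\<le>n. monom (cnj (coeff p i)) (n - i)"
  have 1: "complex_of_real ((norm (poly p z))\<^sup>2) = poly (p * ?q) z / z ^ n" if z: "z \<in> unit_circle" for z
  proof -
    have nz: "z \<noteq> 0" using z by auto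
    hence cz: "cnj z = 1 / z" using circle_mult_cnj[OF z] by (simp add: field_simps)
    have "cnj (poly p z) = (\<Sum>i\<le>n. cnj (coeff p i) * (1 / z) ^ i)"
      by (simp add: poly_altdef_le [OF assms] cz)
    also have "\<dots> = (\<Sum>i\<le>n. cnj (coeff p i) * z ^ (n - i)) / z ^ n"
      unfolding sum_divide_distrib
      by (intro sum.cong refl) (use nz in \<open>auto simp: power_diff power_divide field_simps\<close>)
    also have "\<dots> = poly ?q z / z ^ n" by (simp add: poly_sum poly_monom)
    finally show ?thesis by (simp only: complex_norm_square) simp
  qed
  have "degree ?q \<le> n"
    by (intro degree_sum_le) (auto intro: order.trans[OF degree_monom_le])
  hence "degree (p * ?q) \<le> 2 * n" using degree_mult_le[of p ?q] assms by linarith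
  with 1 show ?thesis unfolding trig_poly_def by blast
qed

text \<open>Negative powers of \<open>z\<close> are conjugates of positive ones on the circle, so
  their integrals follow by conjugation; this respects the factor \<open>d\<close> because it is
  real.\<close>

lemma integral_trig_poly_eq:
  fixes M1 M2 :: "complex measure"
  assumes M1: "finite_measure M1" "sets M1 = sets circle_borel"
    and M2: "finite_measure M2" "sets M2 = sets circle_borel"
    and mom: "\<And>k. k \<le> n \<Longrightarrow> (LINT z|M2. z ^ k) = of_real d * (LINT z|M1. z ^ k)"
    and f: "trig_poly N f" "N \<le> n"
  shows "(LINT z|M2. f z) = of_real d * (LINT z|M1. f z)"
proof -
  from f obtain p where p: "degree p \<le> 2 * N" "\<And>z. z \<in> unit_circle \<Longrightarrow> f z = poly p z / z ^ N"
    by (auto simp: trig_poly_def)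
  have sp: "space M1 = unit_circle" "space M2 = unit_circle"
    using sets_eq_imp_space_eq[OF M1(2)] sets_eq_imp_space_eq[OF M2(2)] by (simp_all add: space_restrict_space)
  define e where "e = (\<lambda>i z. if N \<le> i then z ^ (i - N) else cnj (z ^ (N - i)) :: complex)"
  have ce: "continuous_on unit_circle (e i)" for i
    by (cases "N \<le> i") (auto simp: e_def intro!: continuous_intros)
  have fe: "f z = (\<Sum>i\<le>2 * N. coeff p i * e i z)" if z: "z \<in> unit_circle" for z
  proof -
    have nz: "z \<noteq> 0" using z by auto
    hence cz: "cnj z = 1 / z" using circle_mult_cnj[OF z] by (simp add: field_simps)
    have "z ^ i / z ^ N = e i z" for i
    proof (cases "N \<le> i")
      case True thus ?thesis using nz by (simp add: e_def power_diff)
    next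
      case False
      hence "z ^ N = z ^ i * z ^ (N - i)" by (simp add: power_add[symmetric])
      thus ?thesis using nz False by (simp add: e_def cz power_divide)
    qed
    thus ?thesis
      unfolding p(2)[OF z] poly_altdef_le[OF p(1)] sum_divide_distrib by (intro sum.cong refl) (metis times_divide_eq_right)
  qed
  have ei: "(LINT z|M2. e i z) = of_real d * (LINT z|M1. e i z)" if "i \<le> 2 * N" for i
  proof (cases "N \<le> i")
    case True thus ?thesis using mom[of "i - N"] that f(2) by (simp add: e_def)
  next
    case False
    have "cnj (LINT z|M2. z ^ (N - i)) = cnj (of_real d * (LINT z|M1. z ^ (N - i)))"
      using mom[of "N - i"] f(2) by simp
    thus ?thesis using False by (simp add: e_def del: complex_cnj_power)
  qed
  have L: "(LINT z|M. f z) = (\<Sum>i\<le>2 * N. coeff p i * (LINT z|M. e i z))"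
    if "finite_measure M" "sets M = sets circle_borel" "space M = unit_circle" for M
  proof -
    have "(LINT z|M. f z) = (LINT z|M. (\<Sum>i\<le>2 * N. coeff p i * e i z))"
      by (intro Bochner_Integration.integral_cong refl fe) (use that in auto)
    also have "\<dots> = (\<Sum>i\<le>2 * N. LINT z|M. coeff p i * e i z)"
      by (intro Bochner_Integration.integral_sum integrable_circle_continuous that continuous_intros ce)
    finally show ?thesis by simp
  qed
  show ?thesis
    unfolding L[OF M1 sp(1)] L[OF M2 sp(2)] sum_distrib_left
    by (intro sum.cong refl) (simp add: ei mult_ac)
qed

text \<open>Since \<open>\<phi> k\<close> has a nonzero leading coefficient, the vanishing of its
  integral expresses the moment of order \<open>k\<close> through the lower ones. Both measures obey
  the same linear recurrence, so their moments differ by the ratio of the masses.\<close>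

lemma moments_eq:
  fixes M1 M2 :: "complex measure"
  assumes M1: "prob_space M1" "sets M1 = sets circle_borel"
    and M2: "finite_measure M2" "sets M2 = sets circle_borel"
    and deg: "\<And>k. degree (\<phi> k) = k"
    and orth: "\<And>k. 0 < k \<Longrightarrow> k \<le> n \<Longrightarrow> (LINT z|M1. poly (\<phi> k) z) = 0"
        "\<And>k. 0 < k \<Longrightarrow> k \<le> n \<Longrightarrow> (LINT z|M2. poly (\<phi> k) z) = 0"
    and "k \<le> n"
  shows "(LINT z|M2. z ^ k) = of_real (measure M2 (space M2)) * (LINT z|M1. z ^ k)"
  using \<open>k \<le> n\<close>
proof (induction k rule: less_induct)
  case (less k)
  interpret M1: prob_space M1 by fact
  show ?case
  proof (cases "k = 0")
    case True
    thus ?thesis using M1.prob_space by (simp add: scaleR_conv_of_real)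
  next
    case False
    have L: "(LINT z|M. poly (\<phi> k) z) = (\<Sum>i\<le>k. coeff (\<phi> k) i * (LINT z|M. z ^ i))"
      if "finite_measure M" "sets M = sets circle_borel" for M
    proof -
      have "(LINT z|M. poly (\<phi> k) z) = (LINT z|M. (\<Sum>i\<le>k. coeff (\<phi> k) i * z ^ i))"
        by (simp add: poly_altdef deg)
      also have "\<dots> = (\<Sum>i\<le>k. LINT z|M. coeff (\<phi> k) i * z ^ i)"
        by (intro Bochner_Integration.integral_sum integrable_circle_continuous that continuous_intros)
      finally show ?thesis by simp
    qed
    let ?d = "complex_of_real (measure M2 (space M2))"
    have split: "(\<Sum>i\<le>k. g i) = (\<Sum>i<k. g i) + g k" for g :: "nat \<Rightarrow> complex"
      by (simp add: lessThan_Suc_atMost[symmetric])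
    have c: "coeff (\<phi> k) k \<noteq> 0" using deg[of k] False by (metis degree_0 leading_coeff_0_iff)
    have "(\<Sum>i<k. coeff (\<phi> k) i * (LINT z|M2. z ^ i)) + coeff (\<phi> k) k * (LINT z|M2. z ^ k) = 0"
      using orth(2)[of k] False less.prems L[OF M2] split by simp
    moreover have "(\<Sum>i<k. coeff (\<phi> k) i * (LINT z|M1. z ^ i)) + coeff (\<phi> k) k * (LINT z|M1. z ^ k) = 0"
      using orth(1)[of k] False less.prems L[OF M1.finite_measure_axioms M1(2)] split by simp
    moreover have "(\<Sum>i<k. coeff (\<phi> k) i * (LINT z|M2. z ^ i)) =
        ?d * (\<Sum>i<k. coeff (\<phi> k) i * (LINT z|M1. z ^ i))"
      unfolding sum_distrib_left using less.IH less.prems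
      by (intro sum.cong refl) (simp add: mult_ac)
    ultimately have "coeff (\<phi> k) k * (LINT z|M2. z ^ k) = coeff (\<phi> k) k * (?d * (LINT z|M1. z ^ k))"
      by algebra
    thus ?thesis using c by simp
  qed
qed

locale szego_measure = szego_system +
  fixes \<mu> :: "complex measure"
  assumes prob_\<mu>: "prob_space \<mu>"
    and sets_\<mu>: "sets \<mu> = sets circle_borel"
    and orthonormal: "orthonormal_polys \<mu> \<phi>"
begin

lemma integral_\<phi>:
  assumes "0 < k"
  shows "(LINT z|\<mu>. poly (\<phi> k) z) = 0"
proof -
  obtain c where c: "\<phi> 0 = [:c:]" using degree_0_id[OF degree_\<phi>[of 0]] by metis
  hence "c \<noteq> 0" using \<phi>_nonzero[of 0] by auto
  have "(LINT z|\<mu>. cnj (poly (\<phi> 0) z) * poly (\<phi> k) z) = 0"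
    using orthonormal assms by (simp add: orthonormal_polys_def)
  thus ?thesis using \<open>c \<noteq> 0\<close> by (simp add: c)
qed

text \<open>\<open>moments_eq\<close> gives proportional moments. The factor is found with the
  squared modulus of \<open>\<phi> n\<close>, a trigonometric polynomial of order \<open>n\<close>
  whose integral is 1 for both measures.\<close>

lemma integral_bs_measure_trig_poly:
  assumes "trig_poly n f"
  shows "(LINT z|bs_measure n. f z) = (LINT z|\<mu>. f z)"
proof -
  interpret \<mu>: prob_space \<mu> by (rule prob_\<mu>)
  let ?d = "measure (bs_measure n) (space (bs_measure n))"
  have mom: "(LINT z|bs_measure n. z ^ k) = of_real ?d * (LINT z|\<mu>. z ^ k)" if "k \<le> n" for k
  proof (rule moments_eq[OF prob_\<mu> sets_\<mu> finite_measure_bs_measure sets_bs_measure degree_\<phi> _ _ that])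
    show "(LINT z|\<mu>. poly (\<phi> k) z) = 0" if "0 < k" for k
      using integral_\<phi> that by simp
    show "(LINT z|bs_measure n. poly (\<phi> k) z) = 0" if "0 < k" "k \<le> n" for k
      using bs_measure_orthogonal[of k n 0] that by simp
  qed
  note * = integral_trig_poly_eq[OF \<mu>.finite_measure_axioms sets_\<mu> finite_measure_bs_measure
     sets_bs_measure mom _ order_refl, of n]
  have "(LINT z|\<mu>. complex_of_real ((norm (poly (\<phi> n) z))\<^sup>2)) = (LINT z|\<mu>. cnj (poly (\<phi> n) z) * poly (\<phi> n) z)"
    by (simp only: complex_norm_square mult.commute)
  also have "\<dots> = 1" using orthonormal by (simp add: orthonormal_polys_def)
  finally have "of_real ?d = (LINT z|bs_measure n. complex_of_real ((norm (poly (\<phi> n) z))\<^sup>2))"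
    using *[OF _ trig_poly_norm_square[of "\<phi> n" n]] by (simp add: degree_\<phi> del: of_real_power)
  also have "\<dots> = 1"
    unfolding integral_complex_of_real bs_measure_norm by simp
  finally have "?d = 1" by (metis of_real_eq_1_iff)
  thus ?thesis using *[OF _ assms] by simp
qed

lemma prob_space_bs_measure: "prob_space (bs_measure n)"
proof -
  have "(LINT z|bs_measure n. complex_of_real 1) = (LINT z|\<mu>. complex_of_real 1)"
    by (rule integral_bs_measure_trig_poly) (rule trig_poly_raise[OF trig_poly_const], simp)
  hence "measure (bs_measure n) (space (bs_measure n)) = 1"
    using prob_space.prob_space[OF prob_\<mu>] unfolding integral_complex_of_real of_real_eq_iff by simp
  thus ?thesis
    by (intro prob_spaceI) (simp add: finite_measure.emeasure_eq_measure[OF finite_measure_bs_measure])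
qed

text \<open>For an approximating trigonometric polynomial of order \<open>N\<close> the two
  integrals coincide once \<open>n \<ge> N\<close>. All measures have mass 1, so only two errors of
  at most \<open>e / 3\<close> remain.\<close>

lemma bs_measure_weak_conv:
  fixes f :: "complex \<Rightarrow> real"
  assumes f: "continuous_on unit_circle f"
  shows "(\<lambda>n. LINT z|bs_measure n. f z) \<longlonglongrightarrow> (LINT z|\<mu>. f z)"
proof (rule LIMSEQ_I)
  fix e :: real assume "e > 0"
  hence "e / 3 > 0" by simp
  then obtain g where g: "real_polynomial_function g" "\<And>z. z \<in> unit_circle \<Longrightarrow> \<bar>f z - g z\<bar> < e / 3"
    using Stone_Weierstrass_real_polynomial_function[OF compact_sphere f] by metis
  obtain N where N: "trig_poly N (\<lambda>z. complex_of_real (g z))"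
    using trig_poly_polynomial_function[OF g(1)] by blast
  have cg: "continuous_on unit_circle g"
    using g(1) continuous_on_polymonial_function real_polynomial_function_eq by blast
  have close: "\<bar>(LINT z|M. f z) - (LINT z|M. g z)\<bar> \<le> e / 3" if "prob_space M" "sets M = sets circle_borel" for M
  proof -
    interpret prob_space M by fact
    have sp: "space M = unit_circle"
      using sets_eq_imp_space_eq[OF that(2)] by (simp add: space_restrict_space)
    have if': "integrable M f" and ig: "integrable M g"
      by (intro integrable_circle_continuous finite_measure_axioms that f cg)+
    have "\<bar>(LINT z|M. f z) - (LINT z|M. g z)\<bar> = \<bar>LINT z|M. f z - g z\<bar>"
      using if' ig by simp
    also have "\<dots> \<le> (LINT z|M. \<bar>f z - g z\<bar>)"
      by (rule integral_abs_bound)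
    also have "\<dots> \<le> (LINT z|M. e / 3)"
      using if' ig g(2) sp by (intro integral_mono) (auto intro: less_imp_le)
    finally show ?thesis using prob_space by simp
  qed
  have "norm ((LINT z|bs_measure n. f z) - (LINT z|\<mu>. f z)) < e" if "n \<ge> N" for n
  proof -
    have "(LINT z|bs_measure n. complex_of_real (g z)) = (LINT z|\<mu>. complex_of_real (g z))"
      by (rule integral_bs_measure_trig_poly) (rule trig_poly_raise[OF N that])
    hence "(LINT z|bs_measure n. g z) = (LINT z|\<mu>. g z)"
      unfolding integral_complex_of_real of_real_eq_iff .
    thus ?thesis
      using close[OF prob_space_bs_measure sets_bs_measure, of n] close[OF prob_\<mu> sets_\<mu>] \<open>e > 0\<close>
      unfolding real_norm_def by linarith
  qed
  thus "\<exists>N. \<forall>n\<ge>N. norm ((LINT z|bs_measure n. f z) - (LINT z|\<mu>. f z)) < e" by blast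
qed

end


section \<open>Sequences of generalized bounded variation\<close>

lemma ell_add:
  assumes "f \<in> ell p" "g \<in> ell p"
  shows "(\<lambda>n. f n + g n) \<in> ell p"
proof -
  have bd: "norm (f n + g n) ^ p \<le> 2 ^ p * (norm (f n) ^ p + norm (g n) ^ p)" for n
  proof -
    let ?m = "max (norm (f n)) (norm (g n))"
    have "norm (f n + g n) \<le> 2 * ?m" using norm_triangle_ineq[of "f n" "g n"] by linarith
    hence "norm (f n + g n) ^ p \<le> (2 * ?m) ^ p" by (intro power_mono) auto
    also have "\<dots> = 2 ^ p * ?m ^ p" by (simp add: power_mult_distrib)
    also have "\<dots> \<le> 2 ^ p * (norm (f n) ^ p + norm (g n) ^ p)"
      by (intro mult_left_mono) (auto simp: max_def)
    finally show ?thesis .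
  qed
  have "summable (\<lambda>n. 2 ^ p * (norm (f n) ^ p + norm (g n) ^ p))"
    using assms by (intro summable_mult summable_add) (auto simp: ell_def)
  thus ?thesis unfolding ell_def mem_Collect_eq
    by (rule summable_comparison_test[rotated]) (use bd in auto)
qed

lemma ell_mult_const: "f \<in> ell p \<Longrightarrow> (\<lambda>n. c * f n) \<in> ell p"
  by (auto simp: ell_def norm_mult power_mult_distrib intro: summable_mult)

lemma ell_diff: "f \<in> ell p \<Longrightarrow> g \<in> ell p \<Longrightarrow> (\<lambda>n. f n - g n) \<in> ell p"
  using ell_add[OF _ ell_mult_const[of g p "-1"], of f] by simp

lemma ell_Suc: "f \<in> ell p \<Longrightarrow> (\<lambda>n. f (Suc n)) \<in> ell p"
  unfolding ell_def mem_Collect_eq by (subst (asm) summable_Suc_iff[symmetric])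

lemma ell_sum:
  assumes "p > 0" "\<And>i. i \<in> I \<Longrightarrow> f i \<in> ell p"
  shows "(\<lambda>n. \<Sum>i\<in>I. f i n) \<in> ell p"
proof -
  \<comment> \<open>Here \<open>p > 0\<close> matters, because \<open>0 ^ 0 = 1\<close>.\<close>
  have 0: "(\<lambda>n. 0) \<in> ell p" using assms(1) by (simp add: ell_def zero_power)
  show ?thesis using assms(2)
    by (induction I rule: infinite_finite_induct) (auto simp: 0 intro: ell_add)
qed

lemma summable_norm_imp_ell:
  fixes f :: "nat \<Rightarrow> complex"
  assumes "p > 0" "summable (\<lambda>n. norm (f n))"
  shows "f \<in> ell p"
proof -
  have "eventually (\<lambda>n. norm (f n) < 1) sequentially"
    using summable_LIMSEQ_zero[OF assms(2)] by (rule order_tendstoD) simp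
  hence "eventually (\<lambda>n. norm (norm (f n) ^ p) \<le> norm (f n)) sequentially"
  proof eventually_elim
    case (elim n)
    show ?case using power_decreasing[of 1 p "norm (f n)"] assms(1) elim by simp
  qed
  thus ?thesis unfolding ell_def mem_Collect_eq
    by (rule summable_comparison_test_ev[OF _ assms(2)])
qed

text \<open>Applying \<open>\<omega>\<^sub>0 T - 1\<close>, with \<open>T\<close> the shift, removes the component with phase \<open>\<omega>\<^sub>0\<close> and
  multiplies the one with phase \<open>\<omega>\<close> by \<open>\<omega>\<^sub>0 / \<omega> - 1\<close>, both up to a summable error.\<close>

lemma ell_components:
  assumes "p > 0" "finite \<Omega>" "0 \<notin> \<Omega>"
    and "\<And>\<omega>. \<omega> \<in> \<Omega> \<Longrightarrow> summable (\<lambda>n. norm (\<omega> * \<beta> \<omega> (Suc n) - \<beta> \<omega> n))"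
    and "(\<lambda>n. \<Sum>\<omega>\<in>\<Omega>. \<beta> \<omega> n) \<in> ell p"
    and "\<omega> \<in> \<Omega>"
  shows "\<beta> \<omega> \<in> ell p"
  using assms(2-)
proof (induction \<Omega> arbitrary: \<beta> \<omega> rule: finite_induct)
  case empty
  thus ?case by simp
next
  case (insert \<omega>0 \<Omega>)
  define a where "a n = (\<Sum>\<omega>\<in>insert \<omega>0 \<Omega>. \<beta> \<omega> n)" for n
  define \<delta> where "\<delta> \<omega> n = \<omega> * \<beta> \<omega> (Suc n) - \<beta> \<omega> n" for \<omega> n
  define \<gamma> where "\<gamma> \<omega> n = (\<omega>0 / \<omega> - 1) * \<beta> \<omega> n" for \<omega> n
  have a: "a \<in> ell p" using insert.prems by (simp add: a_def[abs_def])
  have \<delta>: "\<delta> \<omega> \<in> ell p" if "\<omega> \<in> insert \<omega>0 \<Omega>" for \<omega>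
    using insert.prems(2)[OF that] by (intro summable_norm_imp_ell assms) (simp add: \<delta>_def)
  have eq: "(\<Sum>\<omega>\<in>\<Omega>. \<gamma> \<omega> n) = \<omega>0 * a (Suc n) - a n - \<delta> \<omega>0 n - (\<Sum>\<omega>\<in>\<Omega>. \<omega>0 / \<omega> * \<delta> \<omega> n)" for n
  proof -
    have "(\<Sum>\<omega>\<in>\<Omega>. \<gamma> \<omega> n) = (\<Sum>\<omega>\<in>\<Omega>. \<omega>0 * \<beta> \<omega> (Suc n) - \<beta> \<omega> n - \<omega>0 / \<omega> * \<delta> \<omega> n)"
    proof (rule sum.cong[OF refl])
      fix \<omega> assume "\<omega> \<in> \<Omega>"
      hence "\<omega> \<noteq> 0" using insert.prems(1) by auto
      thus "\<gamma> \<omega> n = \<omega>0 * \<beta> \<omega> (Suc n) - \<beta> \<omega> n - \<omega>0 / \<omega> * \<delta> \<omega> n"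
        by (simp add: \<gamma>_def \<delta>_def algebra_simps)
    qed
    also have "\<dots> = \<omega>0 * (\<Sum>\<omega>\<in>\<Omega>. \<beta> \<omega> (Suc n)) - (\<Sum>\<omega>\<in>\<Omega>. \<beta> \<omega> n) - (\<Sum>\<omega>\<in>\<Omega>. \<omega>0 / \<omega> * \<delta> \<omega> n)"
      by (simp add: sum_subtractf sum_distrib_left)
    finally show ?thesis using insert.hyps by (simp add: a_def \<delta>_def algebra_simps)
  qed
  have "\<gamma> \<omega> \<in> ell p" if "\<omega> \<in> \<Omega>" for \<omega>
  proof (rule insert.IH[OF _ _ _ that])
    show "summable (\<lambda>n. norm (\<omega> * \<gamma> \<omega> (Suc n) - \<gamma> \<omega> n))" if "\<omega> \<in> \<Omega>" for \<omega>
    proof -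
      have "\<omega> * \<gamma> \<omega> (Suc n) - \<gamma> \<omega> n = (\<omega>0 / \<omega> - 1) * (\<omega> * \<beta> \<omega> (Suc n) - \<beta> \<omega> n)" for n
        by (simp add: \<gamma>_def algebra_simps)
      thus ?thesis using insert.prems(2)[of \<omega>] that by (simp add: norm_mult summable_mult)
    qed
    show "(\<lambda>n. \<Sum>\<omega>\<in>\<Omega>. \<gamma> \<omega> n) \<in> ell p"
      unfolding eq
      by (intro ell_diff ell_sum ell_mult_const ell_Suc a \<delta> assms) auto
  qed (use insert.prems in auto)
  moreover have "\<beta> \<omega> = (\<lambda>n. 1 / (\<omega>0 / \<omega> - 1) * \<gamma> \<omega> n)" if "\<omega> \<in> \<Omega>" for \<omega>
  proof -
    have "\<omega> \<noteq> 0" "\<omega>0 \<noteq> \<omega>" using that insert by auto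
    hence "\<omega>0 / \<omega> - 1 \<noteq> 0" by simp
    thus ?thesis by (auto simp: \<gamma>_def)
  qed
  ultimately have \<beta>: "\<beta> \<omega> \<in> ell p" if "\<omega> \<in> \<Omega>" for \<omega>
    using that ell_mult_const by metis
  \<comment> \<open>The component at \<open>\<omega>0\<close>, removed above, is recovered as the
    remainder of the sum.\<close>
  have "\<beta> \<omega>0 = (\<lambda>n. a n - (\<Sum>\<omega>\<in>\<Omega>. \<beta> \<omega> n))"
    using insert.hyps by (auto simp: a_def)
  moreover have "\<dots> \<in> ell p" by (intro ell_diff a ell_sum assms \<beta>)
  ultimately show ?case using \<beta> insert.prems(4) by auto
qed

section \<open>Sumsets of angles and finiteness of the exceptional set\<close>

lemma fold_sumset_0: "0 \<in> fold_sumset 0 A"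
  by (auto simp: fold_sumset_def)

lemma fold_sumset_Suc:
  assumes "x \<in> fold_sumset k A" "a \<in> A"
  shows "a + x \<in> fold_sumset (Suc k) A"
proof -
  from assms(1) obtain f where f: "x = (\<Sum>i<k. f i)" "\<forall>i<k. f i \<in> A" by (auto simp: fold_sumset_def)
  have "a + x = (\<Sum>i<Suc k. (f(k := a)) i)" using f(1) by simp
  moreover have "\<forall>i<Suc k. (f(k := a)) i \<in> A" using f(2) assms(2) by (auto simp: less_Suc_eq)
  ultimately show ?thesis unfolding fold_sumset_def by blast
qed

text \<open>Adding \<open>m\<close> copies of \<open>a\<close> to both sums keeps the difference.
  This brings the phases of low order into \<open>exceptional_set\<close>, whose sums have exactly
  \<open>q\<close> and \<open>q - 1\<close> terms.\<close>

lemma fold_sumset_pad: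
  assumes "x \<in> fold_sumset k A" "y \<in> fold_sumset l A" "a \<in> A"
  shows "\<exists>x'\<in>fold_sumset (m + k) A. \<exists>y'\<in>fold_sumset (m + l) A. x' - y' = x - y"
proof (induction m)
  case 0
  thus ?case using assms by auto
next
  case (Suc m)
  then obtain x' y' where "x' \<in> fold_sumset (m + k) A" "y' \<in> fold_sumset (m + l) A" "x' - y' = x - y" by auto
  hence "a + x' \<in> fold_sumset (Suc m + k) A" "a + y' \<in> fold_sumset (Suc m + l) A" "(a + x') - (a + y') = x - y"
    using fold_sumset_Suc[OF _ assms(3)] by auto
  thus ?case by blast
qed

lemma finite_fold_sumset: "finite A \<Longrightarrow> finite (fold_sumset k A)"
proof (induction k)
  case 0
  have "fold_sumset 0 A = {0}" by (auto simp: fold_sumset_def)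
  thus ?case by simp
next
  case (Suc k)
  have "fold_sumset (Suc k) A \<subseteq> (\<lambda>(x, a). x + a) ` (fold_sumset k A \<times> A)"
    by (force simp: fold_sumset_def)
  thus ?case using Suc finite_subset by blast
qed

lemma finite_exceptional_set: "finite A \<Longrightarrow> finite (exceptional_set q A)"
proof -
  assume A: "finite A"
  have "exceptional_set q A \<subseteq> (\<lambda>(x, y). cis (x - y)) ` (fold_sumset q A \<times> fold_sumset (q - 1) A)"
    by (auto simp: exceptional_set_def)
  thus ?thesis
    by (rule finite_subset) (intro finite_imageI finite_cartesian_product finite_fold_sumset A)
qed

text \<open>Components are indexed by points of the circle, not by angles: angles congruent modulo
  \<open>2 * pi\<close> have the same rotation and count as one phase.\<close>

locale gbv_system =
  fixes A :: "real set" and \<beta> :: "complex \<Rightarrow> nat \<Rightarrow> complex" and \<alpha> :: "nat \<Rightarrow> complex" and q :: nat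
  assumes finite_A: "finite A"
    and rotated: "\<omega> \<in> cis ` A \<Longrightarrow> summable (\<lambda>n. norm (\<omega> * \<beta> \<omega> (Suc n) - \<beta> \<omega> n))"
    and ell_\<beta>: "\<omega> \<in> cis ` A \<Longrightarrow> \<beta> \<omega> \<in> ell (2 * q + 1)"
    and \<alpha>_eq: "\<alpha> n = (\<Sum>\<omega>\<in>cis ` A. \<beta> \<omega> n)"
begin

text \<open>One majorant for all components, so that a product of \<open>d\<close> of them is at
  most \<open>B n ^ d\<close>.\<close>

definition B :: "nat \<Rightarrow> real" where
  "B n = (\<Sum>\<omega>\<in>cis ` A. norm (\<beta> \<omega> n))"

lemma B_nonneg: "B n \<ge> 0"
  by (simp add: B_def sum_nonneg)

lemma norm_\<beta>_le_B: "\<omega> \<in> cis ` A \<Longrightarrow> norm (\<beta> \<omega> n) \<le> B n"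
  unfolding B_def using finite_A by (intro member_le_sum) auto

lemma summable_B: "summable (\<lambda>n. B n ^ (2 * q + 1))"
proof -
  have "(\<lambda>n. \<Sum>\<omega>\<in>cis ` A. complex_of_real (norm (\<beta> \<omega> n))) \<in> ell (2 * q + 1)"
    using ell_\<beta> by (intro ell_sum) (auto simp: ell_def)
  hence "(\<lambda>n. complex_of_real (B n)) \<in> ell (2 * q + 1)" by (simp add: B_def)
  thus ?thesis unfolding ell_def using B_nonneg by simp
qed

lemma B_tendsto_0: "B \<longlonglongrightarrow> 0"
proof -
  have "(\<lambda>n. root (2 * q + 1) (B n ^ (2 * q + 1))) \<longlonglongrightarrow> root (2 * q + 1) 0"
    by (intro tendsto_real_root summable_LIMSEQ_zero summable_B)
  moreover have "root (2 * q + 1) (B n ^ (2 * q + 1)) = B n" for n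
    by (rule real_root_power_cancel) (use B_nonneg in auto)
  ultimately show ?thesis by simp
qed

lemma B_bounded: obtains M where "M \<ge> 1" "\<And>n. B n \<le> M"
proof -
  obtain M where "\<And>n. norm (B n) \<le> M"
    using convergent_imp_Bseq[OF convergentI[OF B_tendsto_0]] by (auto simp: Bseq_def)
  hence "\<And>n. B n \<le> max 1 M" by (simp add: B_nonneg) (meson le_max_iff_disj)
  thus ?thesis by (intro that[of "max 1 M"]) auto
qed

text \<open>The third argument is the phase: \<open>w * g (Suc n) - g n\<close> is summable by
  \<open>monomial_rotated\<close>. A conjugate component therefore contributes
  \<open>cnj \<omega>\<close>.\<close>

inductive monomial :: "nat \<Rightarrow> nat \<Rightarrow> complex \<Rightarrow> (nat \<Rightarrow> complex) \<Rightarrow> bool" where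
  one: "monomial 0 0 1 (\<lambda>n. 1)"
| mult: "monomial k l w g \<Longrightarrow> \<omega> \<in> cis ` A \<Longrightarrow> monomial (Suc k) l (\<omega> * w) (\<lambda>n. \<beta> \<omega> n * g n)"
| cnj: "monomial k l w g \<Longrightarrow> \<omega> \<in> cis ` A \<Longrightarrow> monomial k (Suc l) (cnj \<omega> * w) (\<lambda>n. cnj (\<beta> \<omega> n) * g n)"

lemma monomial_mult:
  assumes "monomial k l w g" "monomial k' l' w' g'"
  shows "monomial (k + k') (l + l') (w * w') (\<lambda>n. g n * g' n)"
  using assms(1)
proof induction
  case one
  thus ?case using assms(2) by simp
next
  case (mult k l w g \<omega>)
  from monomial.mult[OF mult.IH mult.hyps(2)] show ?case by (simp add: mult.assoc)
next
  case (cnj k l w g \<omega>)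
  from monomial.cnj[OF cnj.IH cnj.hyps(2)] show ?case by (simp add: mult.assoc)
qed

lemma monomial_bound: "monomial k l w g \<Longrightarrow> norm (g n) \<le> B n ^ (k + l)"
proof (induction rule: monomial.induct)
  case (mult k l w g \<omega>)
  thus ?case using mult_mono[OF norm_\<beta>_le_B[of \<omega> n] mult.IH] B_nonneg[of n] by (simp add: norm_mult)
next
  case (cnj k l w g \<omega>)
  thus ?case using mult_mono[OF norm_\<beta>_le_B[of \<omega> n] cnj.IH] B_nonneg[of n] by (simp add: norm_mult)
qed simp

lemma monomial_norm: "monomial k l w g \<Longrightarrow> norm w = 1"
  by (induction rule: monomial.induct) (auto simp: norm_mult)

lemma monomial_phase:
  "monomial k l w g \<Longrightarrow> \<exists>x\<in>fold_sumset k A. \<exists>y\<in>fold_sumset l A. w = cis (x - y)"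
proof (induction rule: monomial.induct)
  case one
  thus ?case using fold_sumset_0[of A] by (intro bexI[of _ 0]) auto
next
  case (mult k l w g \<omega>)
  then obtain x y a where *: "x \<in> fold_sumset k A" "y \<in> fold_sumset l A" "w = cis (x - y)" "a \<in> A" "\<omega> = cis a" by auto
  hence "\<omega> * w = cis (a + x - y)" by (simp add: cis_mult algebra_simps)
  thus ?case using fold_sumset_Suc[OF *(1) *(4)] *(2) by blast
next
  case (cnj k l w g \<omega>)
  then obtain x y a where *: "x \<in> fold_sumset k A" "y \<in> fold_sumset l A" "w = cis (x - y)" "a \<in> A" "\<omega> = cis a" by auto
  hence "cnj \<omega> * w = cis (x - (a + y))" by (simp add: cis_mult cis_cnj algebra_simps)
  thus ?case using fold_sumset_Suc[OF *(2) *(4)] *(1) by blast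
qed

text \<open>A product rule for rotated differences: phases multiply, and each difference is weighted
  by a bounded factor.\<close>

lemma summable_rotated_mult:
  fixes f g :: "nat \<Rightarrow> complex"
  assumes f: "summable (\<lambda>n. norm (v * f (Suc n) - f n))" "\<And>n. norm (f n) \<le> F"
    and g: "summable (\<lambda>n. norm (w * g (Suc n) - g n))" "\<And>n. norm (g n) \<le> G"
    and "norm v = 1"
  shows "summable (\<lambda>n. norm (v * w * (f (Suc n) * g (Suc n)) - f n * g n))"
proof (rule summable_comparison_test)
  have "norm (v * w * (f (Suc n) * g (Suc n)) - f n * g n) \<le>
      F * norm (w * g (Suc n) - g n) + G * norm (v * f (Suc n) - f n)" for n
  proof -
    have "v * w * (f (Suc n) * g (Suc n)) - f n * g n =
        v * f (Suc n) * (w * g (Suc n) - g n) + g n * (v * f (Suc n) - f n)"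
      by (simp add: algebra_simps)
    also have "norm \<dots> \<le> norm (f (Suc n)) * norm (w * g (Suc n) - g n) + norm (g n) * norm (v * f (Suc n) - f n)"
      by (rule order.trans[OF norm_triangle_ineq]) (simp add: norm_mult assms(5))
    also have "\<dots> \<le> F * norm (w * g (Suc n) - g n) + G * norm (v * f (Suc n) - f n)"
      by (intro add_mono mult_right_mono f g) auto
    finally show ?thesis .
  qed
  thus "\<exists>N. \<forall>n\<ge>N. norm (norm (v * w * (f (Suc n) * g (Suc n)) - f n * g n)) \<le>
      F * norm (w * g (Suc n) - g n) + G * norm (v * f (Suc n) - f n)" by auto
  show "summable (\<lambda>n. F * norm (w * g (Suc n) - g n) + G * norm (v * f (Suc n) - f n))"
    by (intro summable_add summable_mult f g)
qed

lemma monomial_rotated: "monomial k l w g \<Longrightarrow> summable (\<lambda>n. norm (w * g (Suc n) - g n))"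
proof (induction rule: monomial.induct)
  case (mult k l w g \<omega>)
  obtain M where M: "M \<ge> 1" "\<And>n. B n \<le> M" using B_bounded by blast
  have b: "norm (\<beta> \<omega> n) \<le> M" for n using norm_\<beta>_le_B[OF mult.hyps(2)] M(2) by (rule order.trans)
  have g: "norm (g n) \<le> M ^ (k + l)" for n
    using monomial_bound[OF mult.hyps(1), of n] power_mono[OF M(2)[of n] B_nonneg[of n], of "k + l"] by linarith
  have n: "norm \<omega> = 1" using mult.hyps(2) by auto
  show ?case by (rule summable_rotated_mult[OF rotated[OF mult.hyps(2)] b mult.IH g n])
next
  case (cnj k l w g \<omega>)
  obtain M where M: "M \<ge> 1" "\<And>n. B n \<le> M" using B_bounded by blast
  have b: "norm (cnj (\<beta> \<omega> n)) \<le> M" for n using norm_\<beta>_le_B[OF cnj.hyps(2), of n] M(2)[of n] by simp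
  have g: "norm (g n) \<le> M ^ (k + l)" for n
    using monomial_bound[OF cnj.hyps(1), of n] power_mono[OF M(2)[of n] B_nonneg[of n], of "k + l"] by linarith
  have n: "norm (cnj \<omega>) = 1" using cnj.hyps(2) by auto
  have r: "summable (\<lambda>n. norm (cnj \<omega> * cnj (\<beta> \<omega> (Suc n)) - cnj (\<beta> \<omega> n)))"
    using rotated[OF cnj.hyps(2)] by (simp flip: complex_cnj_mult complex_cnj_diff)
  show ?case by (rule summable_rotated_mult[OF r b cnj.IH g n])
qed simp

text \<open>The phase is a difference of sums of \<open>Suc j\<close> and \<open>j\<close> angles.
  The first sum is nonempty, so some \<open>a \<in> A\<close> exists, and \<open>q - Suc j\<close>
  further copies of it on both sides give the numbers of terms in
  \<open>exceptional_set\<close>.\<close>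

lemma monomial_nonresonant:
  assumes "monomial (Suc j) j w g" "j < q"
  shows "w \<in> exceptional_set q A"
proof -
  from monomial_phase[OF assms(1)] obtain x y where xy: "x \<in> fold_sumset (Suc j) A" "y \<in> fold_sumset j A" "w = cis (x - y)" by auto
  obtain a where a: "a \<in> A" using xy(1) by (auto simp: fold_sumset_def)
  obtain x' y' where "x' \<in> fold_sumset (q - Suc j + Suc j) A" "y' \<in> fold_sumset (q - Suc j + j) A" "x' - y' = x - y"
    using fold_sumset_pad[OF xy(1,2) a] by blast
  moreover have "q - Suc j + Suc j = q" "q - Suc j + j = q - 1" using assms(2) by auto
  ultimately have "x' \<in> fold_sumset q A" "y' \<in> fold_sumset (q - 1) A" "w = cis (x' - y')" using xy(3) by auto
  moreover have "q \<noteq> 0" using assms(2) by auto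
  ultimately show ?thesis unfolding exceptional_set_def by auto
qed

end


section \<open>An approximate solution of the Riccati recursion\<close>

text \<open>Off the exceptional set the divisors \<open>1 - z * cnj w\<close> that arise do not
  vanish; compactness then bounds their reciprocals uniformly.\<close>

locale gbv_system_compact = gbv_system +
  fixes C :: "complex set"
  assumes compact_C: "compact C"
    and C_circle: "C \<subseteq> unit_circle - exceptional_set q A"
begin

text \<open>Coefficients depend on \<open>z\<close> alone and monomials on \<open>n\<close> alone,
  so the shift acts on the monomials only.\<close>

inductive homog :: "nat \<Rightarrow> nat \<Rightarrow> (nat \<Rightarrow> complex \<Rightarrow> complex) \<Rightarrow> bool" where
  zero: "homog k l (\<lambda>n z. 0)"
| add: "homog k l u \<Longrightarrow> continuous_on C c \<Longrightarrow> monomial k l w g \<Longrightarrow> homog k l (\<lambda>n z. u n z + c z * g n)"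

text \<open>Summability uniform in \<open>z\<close>, by a majorant; the equations for
  \<open>t\<close> are solved modulo such errors.\<close>

definition negligible :: "(nat \<Rightarrow> complex \<Rightarrow> complex) \<Rightarrow> bool" where
  "negligible u \<longleftrightarrow> (\<exists>\<epsilon>. summable \<epsilon> \<and> (\<forall>n. \<forall>z\<in>C. norm (u n z) \<le> \<epsilon> n))"

lemma continuous_bounded:
  assumes "continuous_on C c"
  obtains K where "K \<ge> 0" "\<And>z. z \<in> C \<Longrightarrow> norm (c z :: complex) \<le> K"
proof -
  have "bounded (c ` C)"
    using compact_continuous_image[OF assms compact_C] by (rule compact_imp_bounded)
  then obtain K where "\<And>z. z \<in> C \<Longrightarrow> norm (c z) \<le> K" by (auto simp: bounded_iff)
  hence "\<And>z. z \<in> C \<Longrightarrow> norm (c z) \<le> max 0 K" by (meson le_max_iff_disj)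
  thus ?thesis by (intro that[of "max 0 K"]) auto
qed

section \<open>Rules for negligible errors\<close>

lemma negligible_eq:
  "negligible v \<Longrightarrow> (\<And>n z. z \<in> C \<Longrightarrow> u n z = v n z) \<Longrightarrow> negligible u"
  by (simp add: negligible_def)

lemma negligible_zero: "negligible (\<lambda>n z. 0)"
  unfolding negligible_def by (intro exI[of _ "\<lambda>n. 0"]) auto

lemma negligible_add:
  assumes "negligible u" "negligible v"
  shows "negligible (\<lambda>n z. u n z + v n z)"
proof -
  from assms obtain a b where a: "summable a" "\<And>n z. z \<in> C \<Longrightarrow> norm (u n z) \<le> a n"
    and b: "summable b" "\<And>n z. z \<in> C \<Longrightarrow> norm (v n z) \<le> b n"
    unfolding negligible_def by metis
  have "norm (u n z + v n z) \<le> a n + b n" if "z \<in> C" for n z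
    by (rule norm_triangle_le) (intro add_mono a(2) b(2) that)
  thus ?thesis unfolding negligible_def
    by (intro exI[of _ "\<lambda>n. a n + b n"]) (auto intro: summable_add a b)
qed

lemma negligible_mult:
  assumes "negligible u" "\<And>n z. z \<in> C \<Longrightarrow> norm (c n z) \<le> K"
  shows "negligible (\<lambda>n z. c n z * u n z)"
proof -
  from assms obtain a where a: "summable a" "\<And>n z. z \<in> C \<Longrightarrow> norm (u n z) \<le> a n"
    unfolding negligible_def by metis
  have "norm (c n z * u n z) \<le> K * a n" if "z \<in> C" for n z
    unfolding norm_mult
    by (rule mult_mono') (use a(2) assms(2) that in auto)
  thus ?thesis unfolding negligible_def
    by (intro exI[of _ "\<lambda>n. K * a n"]) (auto intro: summable_mult a)
qed

lemma negligible_uminus: "negligible u \<Longrightarrow> negligible (\<lambda>n z. - u n z)"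
  by (simp add: negligible_def)

lemma negligible_diff: "negligible u \<Longrightarrow> negligible v \<Longrightarrow> negligible (\<lambda>n z. u n z - v n z)"
  using negligible_add[OF _ negligible_uminus] by simp

lemma negligible_sum: "(\<And>i. i \<in> I \<Longrightarrow> negligible (f i)) \<Longrightarrow> negligible (\<lambda>n z. \<Sum>i\<in>I. f i n z)"
  by (induction I rule: infinite_finite_induct) (auto simp: negligible_zero intro: negligible_add)

section \<open>The algebra of homogeneous sequences\<close>

lemma homog_single:
  assumes "continuous_on C c" "monomial k l w g"
  shows "homog k l (\<lambda>n z. c z * g n)"
  using homog.add[OF homog.zero assms] by simp

lemma homog_add:
  assumes "homog k l u" "homog k l v"
  shows "homog k l (\<lambda>n z. u n z + v n z)"
  using assms(2,1)
proof induction
  case (add k l v c w g)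
  from homog.add[OF add.IH[OF add.prems] add.hyps(2,3)] show ?case by (simp add: add.assoc)
qed simp

lemma homog_sum: "(\<And>i. i \<in> I \<Longrightarrow> homog k l (f i)) \<Longrightarrow> homog k l (\<lambda>n z. \<Sum>i\<in>I. f i n z)"
  by (induction I rule: infinite_finite_induct) (auto simp: homog.zero intro: homog_add)

lemma homog_mult_single:
  assumes "homog k l u" "continuous_on C c" "monomial k' l' w' g'"
  shows "homog (k + k') (l + l') (\<lambda>n z. u n z * (c z * g' n))"
  using assms(1)
proof induction
  case (zero k l)
  show ?case using homog.zero by simp
next
  case (add k l u d w g)
  have "continuous_on C (\<lambda>z. d z * c z)" by (intro continuous_intros assms add.hyps)
  from homog.add[OF add.IH this monomial_mult[OF add.hyps(3) assms(3)]]
  have "homog (k + k') (l + l') (\<lambda>n z. u n z * (c z * g' n) + (d z * c z) * (g n * g' n))" .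
  thus ?case by (simp add: algebra_simps)
qed

lemma homog_mult:
  assumes "homog k l u" "homog k' l' v"
  shows "homog (k + k') (l + l') (\<lambda>n z. u n z * v n z)"
  using assms(2,1)
proof induction
  case (zero k' l')
  show ?case using homog.zero by simp
next
  case (add k' l' v c w g)
  from homog_add[OF add.IH[OF add.prems] homog_mult_single[OF add.prems add.hyps(2,3)]]
  show ?case by (simp add: algebra_simps)
qed

lemma homog_uminus: "homog k l u \<Longrightarrow> homog k l (\<lambda>n z. - u n z)"
  using homog_mult_single[of k l u "\<lambda>z. -1", OF _ _ monomial.one] by simp

lemma homog_continuous: "homog k l u \<Longrightarrow> continuous_on C (u n)"
proof (induction rule: homog.induct)
  case (add k l u c w g)
  have "continuous_on C (\<lambda>z. u n z + c z * g n)" using add by (intro continuous_intros)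
  thus ?case by simp
qed simp

lemma homog_bound: "homog k l u \<Longrightarrow> \<exists>K\<ge>0. \<forall>n. \<forall>z\<in>C. norm (u n z) \<le> K * B n ^ (k + l)"
proof (induction rule: homog.induct)
  case (add k l u c w g)
  then obtain K where K: "K \<ge> 0" "\<And>n z. z \<in> C \<Longrightarrow> norm (u n z) \<le> K * B n ^ (k + l)" by blast
  obtain L where L: "L \<ge> 0" "\<And>z. z \<in> C \<Longrightarrow> norm (c z) \<le> L" using continuous_bounded[OF add.hyps(2)] by blast
  have "norm (u n z + c z * g n) \<le> (K + L) * B n ^ (k + l)" if "z \<in> C" for n z
  proof -
    have "norm (c z * g n) \<le> L * B n ^ (k + l)"
      unfolding norm_mult by (rule mult_mono') (use L that monomial_bound[OF add.hyps(3)] in auto)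
    from norm_triangle_le[OF add_mono[OF K(2)[OF that, of n] this]]
    show ?thesis by (simp add: algebra_simps)
  qed
  thus ?case using K(1) L(1) by (intro exI[of _ "K + L"]) auto
qed (auto intro!: exI[of _ 0])

lemma homog_bounded:
  assumes "homog k l u"
  shows "\<exists>K. \<forall>n. \<forall>z\<in>C. norm (u n z) \<le> K"
proof -
  obtain K where K: "K \<ge> 0" "\<And>n z. z \<in> C \<Longrightarrow> norm (u n z) \<le> K * B n ^ (k + l)"
    using homog_bound[OF assms] by blast
  obtain M where M: "M \<ge> 1" "\<And>n. B n \<le> M" using B_bounded by blast
  have "norm (u n z) \<le> K * M ^ (k + l)" if "z \<in> C" for n z
    using K(2)[OF that, of n] mult_left_mono[OF power_mono[OF M(2)[of n] B_nonneg[of n], of "k + l"] K(1)] by linarith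
  thus ?thesis by blast
qed

text \<open>Once the order reaches \<open>2 * q + 1\<close>, the summability of
  \<open>B n ^ (2 * q + 1)\<close> applies; surplus powers of \<open>B\<close> are absorbed by its
  bound.\<close>

lemma homog_negligible:
  assumes "homog k l u" "k + l \<ge> 2 * q + 1"
  shows "negligible u"
proof -
  obtain K where K: "K \<ge> 0" "\<And>n z. z \<in> C \<Longrightarrow> norm (u n z) \<le> K * B n ^ (k + l)"
    using homog_bound[OF assms(1)] by blast
  obtain M where M: "M \<ge> 1" "\<And>n. B n \<le> M" using B_bounded by blast
  define r where "r = k + l - (2 * q + 1)"
  have r: "k + l = r + (2 * q + 1)" using assms(2) by (simp add: r_def)
  have "norm (u n z) \<le> K * M ^ r * B n ^ (2 * q + 1)" if "z \<in> C" for n z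
  proof -
    have "B n ^ (k + l) \<le> M ^ r * B n ^ (2 * q + 1)"
      unfolding r power_add[of _ r]
      by (intro mult_right_mono power_mono M B_nonneg zero_le_power)
    thus ?thesis using K(2)[OF that, of n] mult_left_mono[OF _ K(1)] by (fastforce simp: mult.assoc)
  qed
  thus ?thesis unfolding negligible_def
    by (intro exI[of _ "\<lambda>n. K * M ^ r * B n ^ (2 * q + 1)"] conjI summable_mult summable_B) auto
qed

section \<open>Shift and division modulo negligible errors\<close>

lemma negligible_coeff_mult:
  assumes "continuous_on C c" "summable (\<lambda>n. norm (d n))"
  shows "negligible (\<lambda>n z. c z * d n)"
proof -
  obtain K where K: "K \<ge> 0" "\<And>z. z \<in> C \<Longrightarrow> norm (c z) \<le> K" using continuous_bounded[OF assms(1)] by blast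
  have "negligible (\<lambda>n z. d n)" unfolding negligible_def using assms(2) by blast
  from negligible_mult[OF this, of "\<lambda>n z. c z"] K(2) show ?thesis by blast
qed

text \<open>For a monomial of phase \<open>w\<close>, \<open>g (Suc n)\<close> is
  \<open>cnj w * g n\<close> up to a summable error, so the shift only changes the
  coefficient.\<close>

lemma homog_shift:
  "homog k l u \<Longrightarrow> \<exists>v. homog k l v \<and> negligible (\<lambda>n z. u (Suc n) z - v n z)"
proof (induction rule: homog.induct)
  case (zero k l)
  show ?case using homog.zero negligible_zero by (intro exI[of _ "\<lambda>n z. 0"]) simp
next
  case (add k l u c w g)
  then obtain v where v: "homog k l v" "negligible (\<lambda>n z. u (Suc n) z - v n z)" by blast
  have cc: "continuous_on C (\<lambda>z. c z * cnj w)" using add.hyps(2) by (intro continuous_intros)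
  have w: "cnj w * w = 1" using monomial_norm[OF add.hyps(3)] by (metis complex_norm_square mult.commute of_real_1 one_power2)
  have eq: "u (Suc n) z + c z * g (Suc n) - (v n z + c z * cnj w * g n) =
      (u (Suc n) z - v n z) + c z * cnj w * (w * g (Suc n) - g n)" for n z
  proof -
    have "c z * cnj w * (w * g (Suc n)) = c z * (cnj w * w) * g (Suc n)" by (simp add: mult_ac)
    thus ?thesis using w by (simp add: algebra_simps)
  qed
  have "negligible (\<lambda>n z. (u (Suc n) z - v n z) + c z * cnj w * (w * g (Suc n) - g n))"
    by (intro negligible_add v negligible_coeff_mult cc monomial_rotated[OF add.hyps(3)])
  from negligible_eq[OF this eq] show ?case using homog.add[OF v(1) cc add.hyps(3)]
    by (intro exI[of _ "\<lambda>n z. v n z + c z * cnj w * g n"] conjI)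
qed

text \<open>Dividing the coefficient of a monomial of phase \<open>w\<close> by
  \<open>1 - z * cnj w\<close> solves the equation up to a multiple of its rotated difference. The
  relation \<open>k = Suc j\<close> is a premise of its own, so that both indices are variables for
  the rule induction.\<close>

lemma homog_solve_aux:
  "homog k j u \<Longrightarrow> k = Suc j \<Longrightarrow> j < q \<Longrightarrow>
    \<exists>v. homog k j v \<and> negligible (\<lambda>n z. v n z - z * v (Suc n) z - u n z)"
proof (induction rule: homog.induct)
  case (zero k l)
  show ?case using homog.zero negligible_zero by (intro exI[of _ "\<lambda>n z. 0"]) simp
next
  case (add k l u c w g)
  then obtain v where v: "homog k l v" "negligible (\<lambda>n z. v n z - z * v (Suc n) z - u n z)" by blast
  have w: "cnj w * w = 1" using monomial_norm[OF add.hyps(3)] by (metis complex_norm_square mult.commute of_real_1 one_power2)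
  \<comment> \<open>As \<open>w\<close> is unimodular, the divisor vanishes only at
    \<open>z = w\<close>, a point of the exceptional set.\<close>
  have nz: "1 - z * cnj w \<noteq> 0" if "z \<in> C" for z
  proof
    assume "1 - z * cnj w = 0"
    hence "w = z * (cnj w * w)" by (simp add: mult.assoc[symmetric])
    hence "w = z" using w by simp
    moreover have "w \<in> exceptional_set q A"
      using monomial_nonresonant add.hyps(3) add.prems by blast
    ultimately show False using that C_circle by blast
  qed
  define d where "d z = c z / (1 - z * cnj w)" for z
  have cd: "continuous_on C d"
    unfolding d_def using add.hyps(2) nz by (intro continuous_intros) auto
  have cd': "continuous_on C (\<lambda>z. - (d z * (z * cnj w)))" using cd by (intro continuous_intros)
  have eq: "(v n z + d z * g n) - z * (v (Suc n) z + d z * g (Suc n)) - (u n z + c z * g n) =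
      (v n z - z * v (Suc n) z - u n z) + - (d z * (z * cnj w)) * (w * g (Suc n) - g n)" if z: "z \<in> C" for n z
  proof -
    have c: "c z = d z * (1 - z * cnj w)" using nz[OF z] by (simp add: d_def)
    have "d z * (z * cnj w) * (w * g (Suc n)) = d z * z * (cnj w * w) * g (Suc n)" by (simp add: mult_ac)
    thus ?thesis unfolding c using w by (simp add: algebra_simps)
  qed
  have "negligible (\<lambda>n z. (v n z - z * v (Suc n) z - u n z) + - (d z * (z * cnj w)) * (w * g (Suc n) - g n))"
    by (intro negligible_add v negligible_coeff_mult cd' monomial_rotated[OF add.hyps(3)])
  from negligible_eq[OF this eq] show ?case using homog.add[OF v(1) cd add.hyps(3)] by blast
qed

lemma homog_solve:
  assumes "homog (Suc j) j u" "j < q"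
  shows "\<exists>v. homog (Suc j) j v \<and> negligible (\<lambda>n z. v n z - z * v (Suc n) z - u n z)"
  using homog_solve_aux[OF assms(1) refl assms(2)] .

section \<open>The Riccati recursion, solved order by order\<close>

lemma homog_\<alpha>: "homog 1 0 (\<lambda>n z. z * \<alpha> n)"
proof -
  have "homog 1 0 (\<lambda>n z. z * \<beta> \<omega> n)" if "\<omega> \<in> cis ` A" for \<omega>
    using homog_single[OF continuous_on_id monomial.mult[OF monomial.one that]] by simp
  from homog_sum[OF this] show ?thesis by (simp add: \<alpha>_eq sum_distrib_left)
qed

lemma homog_cnj_\<alpha>: "homog 0 1 (\<lambda>n z. cnj (\<alpha> n))"
proof -
  have "homog 0 1 (\<lambda>n z. cnj (\<beta> \<omega> n))" if "\<omega> \<in> cis ` A" for \<omega>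
    using homog_single[OF continuous_on_const[of _ 1] monomial.cnj[OF monomial.one that]] by simp
  from homog_sum[OF this] show ?thesis by (simp add: \<alpha>_eq)
qed

text \<open>The part of bidegree \<open>(j + 1, j)\<close> of \<open>z \<alpha>\<^sub>n - cnj \<alpha>\<^sub>n t\<^sub>n t\<^sub>n\<^sub>+\<^sub>1\<close> for \<open>t = u\<^sub>0 + u\<^sub>1 + \<dots>\<close>.\<close>

definition riccati_rhs :: "(nat \<Rightarrow> nat \<Rightarrow> complex \<Rightarrow> complex) \<Rightarrow> nat \<Rightarrow> nat \<Rightarrow> complex \<Rightarrow> complex" where
  "riccati_rhs u j n z =
    (case j of 0 \<Rightarrow> z * \<alpha> n | Suc k \<Rightarrow> - (cnj (\<alpha> n) * (\<Sum>a\<le>k. u a n z * u (k - a) (Suc n) z)))"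

text \<open>\<open>riccati_rhs u m\<close> involves only the \<open>u a\<close> with
  \<open>a < m\<close>. Once its shifted factors are replaced through \<open>homog_shift\<close> it
  has bidegree \<open>(Suc m, m)\<close>, and \<open>homog_solve\<close> supplies the next
  component.\<close>

lemma riccati_components:
  "m \<le> q \<Longrightarrow> \<exists>u. \<forall>j<m. homog (Suc j) j (u j) \<and>
     negligible (\<lambda>n z. u j n z - z * u j (Suc n) z - riccati_rhs u j n z)"
proof (induction m)
  case 0
  show ?case by simp
next
  case (Suc m)
  then obtain u where u: "\<And>j. j < m \<Longrightarrow> homog (Suc j) j (u j)"
    "\<And>j. j < m \<Longrightarrow> negligible (\<lambda>n z. u j n z - z * u j (Suc n) z - riccati_rhs u j n z)" by fastforce
  have "\<exists>h. homog (Suc m) m h \<and> negligible (\<lambda>n z. riccati_rhs u m n z - h n z)"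
  proof (cases m)
    case 0
    thus ?thesis using homog_\<alpha> negligible_zero by (intro exI[of _ "\<lambda>n z. z * \<alpha> n"]) (simp add: riccati_rhs_def)
  next
    case (Suc k)
    have "\<forall>j\<in>{..<m}. \<exists>v. homog (Suc j) j v \<and> negligible (\<lambda>n z. u j (Suc n) z - v n z)"
      using homog_shift u(1) by blast
    then obtain v where v: "\<And>j. j < m \<Longrightarrow> homog (Suc j) j (v j)"
      "\<And>j. j < m \<Longrightarrow> negligible (\<lambda>n z. u j (Suc n) z - v j n z)" using bchoice by (metis lessThan_iff)
    let ?h = "\<lambda>n z. - (cnj (\<alpha> n) * (\<Sum>a\<le>k. u a n z * v (k - a) n z))"
    have "homog (0 + Suc m) (1 + k) (\<lambda>n z. cnj (\<alpha> n) * (\<Sum>a\<le>k. u a n z * v (k - a) n z))"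
    proof (rule homog_mult[OF homog_cnj_\<alpha> homog_sum])
      fix a assume "a \<in> {..k}"
      hence a: "a \<le> k" by simp
      have "homog (Suc a + Suc (k - a)) (a + (k - a)) (\<lambda>n z. u a n z * v (k - a) n z)"
        by (rule homog_mult) (use a Suc in \<open>auto intro!: u v\<close>)
      thus "homog (Suc m) k (\<lambda>n z. u a n z * v (k - a) n z)" using a Suc by simp
    qed
    hence 1: "homog (Suc m) m ?h" using Suc homog_uminus by simp
    have 2: "riccati_rhs u m n z - ?h n z = - (cnj (\<alpha> n) * (\<Sum>a\<le>k. u a n z * (u (k - a) (Suc n) z - v (k - a) n z)))" for n z
      by (simp add: riccati_rhs_def Suc right_diff_distrib sum_subtractf)
    obtain K where K: "\<And>n z. z \<in> C \<Longrightarrow> norm (cnj (\<alpha> n)) \<le> K"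
      using homog_bounded[OF homog_cnj_\<alpha>] by blast
    have "negligible (\<lambda>n z. riccati_rhs u m n z - ?h n z)"
      unfolding 2
    proof (intro negligible_uminus negligible_mult[OF negligible_sum K])
      fix a assume "a \<in> {..k}"
      hence a: "a < m" "k - a < m" using Suc by auto
      obtain L where "\<And>n z. z \<in> C \<Longrightarrow> norm (u a n z) \<le> L" using homog_bounded[OF u(1)[OF a(1)]] by blast
      thus "negligible (\<lambda>n z. u a n z * (u (k - a) (Suc n) z - v (k - a) n z))"
        by (rule negligible_mult[OF v(2)[OF a(2)]])
    qed
    thus ?thesis using 1 by blast
  qed
  then obtain h where h: "homog (Suc m) m h" "negligible (\<lambda>n z. riccati_rhs u m n z - h n z)" by blast
  obtain v where v: "homog (Suc m) m v" "negligible (\<lambda>n z. v n z - z * v (Suc n) z - h n z)"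
    using homog_solve[OF h(1)] Suc.prems by auto
  have "negligible (\<lambda>n z. v n z - z * v (Suc n) z - riccati_rhs u m n z)"
    by (rule negligible_eq[OF negligible_diff[OF v(2) h(2)]]) simp
  \<comment> \<open>Right-hand sides up to \<open>m\<close> read only indices below
    \<open>m\<close>, so they survive the update.\<close>
  moreover have "riccati_rhs (u(m := v)) j = riccati_rhs u j" if "j \<le> m" for j
    using that by (auto simp: riccati_rhs_def fun_eq_iff split: nat.split intro!: sum.cong)
  ultimately have "\<forall>j<Suc m. homog (Suc j) j ((u(m := v)) j) \<and>
     negligible (\<lambda>n z. (u(m := v)) j n z - z * (u(m := v)) j (Suc n) z - riccati_rhs (u(m := v)) j n z)"
    using v(1) u by (auto simp: less_Suc_eq)
  thus ?case by blast
qed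

text \<open>Summing the equations of \<open>riccati_components\<close> accounts for the products
  with \<open>a + b < q - 1\<close>; the other ones, with their factor
  \<open>cnj (\<alpha> n)\<close>, have order at least \<open>2 * q + 1\<close>.\<close>

lemma riccati_approx_solution:
  "\<exists>t K. (\<forall>n. continuous_on C (t n)) \<and> (\<forall>n. \<forall>z\<in>C. norm (t n z) \<le> K * B n) \<and>
    negligible (\<lambda>n z. t n z - z * t (Suc n) z - z * \<alpha> n + cnj (\<alpha> n) * t n z * t (Suc n) z)"
proof (cases q)
  \<comment> \<open>There are no components and \<open>t = 0\<close> works, since for exponent 1 the
    sequence \<open>\<alpha>\<close> is itself summable.\<close>
  case 0
  have "negligible (\<lambda>n z. z * \<alpha> n)" using homog_negligible[OF homog_\<alpha>] 0 by simp
  from negligible_uminus[OF this] show ?thesis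
    by (intro exI[of _ "\<lambda>n z. 0"] exI[of _ 0]) simp
next
  case (Suc r)
  obtain u where u: "\<And>j. j < q \<Longrightarrow> homog (Suc j) j (u j)"
    "\<And>j. j < q \<Longrightarrow> negligible (\<lambda>n z. u j n z - z * u j (Suc n) z - riccati_rhs u j n z)"
    using riccati_components[OF order_refl] by blast
  define t where "t n z = (\<Sum>j<q. u j n z)" for n z
  \<comment> \<open>The part of \<open>t n z * t (Suc n) z\<close> that the right-hand sides
    contain: pairs of indices with sum below \<open>r = q - 1\<close>.\<close>
  define S where "S n z = (\<Sum>k<r. \<Sum>a\<le>k. u a n z * u (k - a) (Suc n) z)" for n z
  have tt: "t n z * t (Suc n) z - S n z = (\<Sum>(a, b)\<in>{..<q} \<times> {..<q} - {(a, b). a + b < r}. u a n z * u b (Suc n) z)" for n z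
  proof -
    have S: "S n z = (\<Sum>(a, b)\<in>{(a, b). a + b < r}. u a n z * u b (Suc n) z)"
      unfolding S_def by (rule sum.triangle_reindex[symmetric])
    have "t n z * t (Suc n) z = (\<Sum>(a, b)\<in>{..<q} \<times> {..<q}. u a n z * u b (Suc n) z)"
      unfolding t_def sum_product sum.cartesian_product ..
    moreover have "{(a, b). a + b < r} \<subseteq> {..<q} \<times> {..<q}" using Suc by auto
    ultimately show ?thesis unfolding S by (subst sum_diff) auto
  qed
  obtain K where K: "\<And>n z. z \<in> C \<Longrightarrow> norm (cnj (\<alpha> n)) \<le> K"
    using homog_bounded[OF homog_cnj_\<alpha>] by blast
  have tail: "negligible (\<lambda>n z. \<Sum>(a, b)\<in>{..<q} \<times> {..<q} - {(a, b). a + b < r}. cnj (\<alpha> n) * (u a n z * u b (Suc n) z))"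
  proof (rule negligible_sum)
    fix x assume "x \<in> {..<q} \<times> {..<q} - {(a, b). a + b < r}"
    then obtain a b where x: "x = (a, b)" and ab: "a < q" "b < q" "\<not> a + b < r" by auto
    obtain v where v: "homog (Suc b) b v" "negligible (\<lambda>n z. u b (Suc n) z - v n z)"
      using homog_shift[OF u(1), of b] ab by auto
    \<comment> \<open>The order is \<open>2 * (a + b) + 3\<close>, which is at least
      \<open>2 * r + 3 = 2 * q + 1\<close>.\<close>
    have "homog (0 + (Suc a + Suc b)) (1 + (a + b)) (\<lambda>n z. cnj (\<alpha> n) * (u a n z * v n z))"
      by (intro homog_mult homog_cnj_\<alpha> u v) (use ab in auto)
    hence 1: "negligible (\<lambda>n z. cnj (\<alpha> n) * (u a n z * v n z))"
      by (rule homog_negligible) (use ab Suc in auto)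
    obtain L where L: "\<And>n z. z \<in> C \<Longrightarrow> norm (u a n z) \<le> L" using homog_bounded[OF u(1)[of a]] ab by auto
    have 2: "negligible (\<lambda>n z. cnj (\<alpha> n) * (u a n z * (u b (Suc n) z - v n z)))"
      by (intro negligible_mult[OF _ K] negligible_mult[OF v(2) L])
    show "negligible (\<lambda>n z. case x of (a, b) \<Rightarrow> cnj (\<alpha> n) * (u a n z * u b (Suc n) z))"
      by (rule negligible_eq[OF negligible_add[OF 1 2]]) (simp add: x algebra_simps)
  qed
  have "negligible (\<lambda>n z. (\<Sum>j<q. u j n z - z * u j (Suc n) z - riccati_rhs u j n z) +
      (\<Sum>(a, b)\<in>{..<q} \<times> {..<q} - {(a, b). a + b < r}. cnj (\<alpha> n) * (u a n z * u b (Suc n) z)))"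
    by (intro negligible_add negligible_sum u(2) tail) auto
  also have "(\<lambda>n z. (\<Sum>j<q. u j n z - z * u j (Suc n) z - riccati_rhs u j n z) +
      (\<Sum>(a, b)\<in>{..<q} \<times> {..<q} - {(a, b). a + b < r}. cnj (\<alpha> n) * (u a n z * u b (Suc n) z))) =
      (\<lambda>n z. t n z - z * t (Suc n) z - z * \<alpha> n + cnj (\<alpha> n) * t n z * t (Suc n) z)"
  proof (intro ext)
    fix n z
    have s1: "(\<Sum>j<q. riccati_rhs u j n z) = z * \<alpha> n - cnj (\<alpha> n) * S n z"
      unfolding Suc sum.lessThan_Suc_shift
      by (simp add: riccati_rhs_def S_def sum_negf sum_distrib_left)
    have s2: "(\<Sum>(a, b)\<in>{..<q} \<times> {..<q} - {(a, b). a + b < r}. cnj (\<alpha> n) * (u a n z * u b (Suc n) z)) =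
        cnj (\<alpha> n) * (t n z * t (Suc n) z - S n z)"
      unfolding tt sum_distrib_left by (intro sum.cong) auto
    have s3: "(\<Sum>j<q. u j n z - z * u j (Suc n) z - riccati_rhs u j n z) =
        t n z - z * t (Suc n) z - (\<Sum>j<q. riccati_rhs u j n z)"
      by (simp add: sum_subtractf t_def sum_distrib_left)
    show "(\<Sum>j<q. u j n z - z * u j (Suc n) z - riccati_rhs u j n z) +
      (\<Sum>(a, b)\<in>{..<q} \<times> {..<q} - {(a, b). a + b < r}. cnj (\<alpha> n) * (u a n z * u b (Suc n) z)) =
      t n z - z * t (Suc n) z - z * \<alpha> n + cnj (\<alpha> n) * t n z * t (Suc n) z"
      unfolding s3 s1 s2 by (simp add: algebra_simps)
  qed
  finally have neg: "negligible (\<lambda>n z. t n z - z * t (Suc n) z - z * \<alpha> n + cnj (\<alpha> n) * t n z * t (Suc n) z)" .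
  have cont: "continuous_on C (t n)" for n
    unfolding t_def[abs_def] by (intro continuous_intros homog_continuous[OF u(1)]) auto
  obtain M where M: "M \<ge> 1" "\<And>n. B n \<le> M" using B_bounded by blast
  \<comment> \<open>\<open>u j\<close> has order \<open>2 * j + 1\<close>; all powers of
    \<open>B\<close> but one go into the constant.\<close>
  have "\<exists>L. \<forall>n. \<forall>z\<in>C. norm (u j n z) \<le> L * B n" if j: "j < q" for j
  proof -
    obtain L where L: "L \<ge> 0" "\<And>n z. z \<in> C \<Longrightarrow> norm (u j n z) \<le> L * B n ^ (Suc j + j)"
      using homog_bound[OF u(1)[OF j]] by blast
    have "norm (u j n z) \<le> L * M ^ (2 * j) * B n" if "z \<in> C" for n z
    proof -
      have "B n ^ (Suc j + j) = B n ^ (2 * j) * B n" by (simp add: mult_2)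
      also have "\<dots> \<le> M ^ (2 * j) * B n"
        by (intro mult_right_mono power_mono M B_nonneg)
      finally show ?thesis
        using L(2)[OF that, of n] mult_left_mono[OF _ L(1)] by (fastforce simp: mult.assoc)
    qed
    thus ?thesis by blast
  qed
  then obtain L where L: "\<And>j n z. j < q \<Longrightarrow> z \<in> C \<Longrightarrow> norm (u j n z) \<le> L j * B n" by metis
  have "norm (t n z) \<le> (\<Sum>j<q. L j) * B n" if "z \<in> C" for n z
    unfolding t_def sum_distrib_right by (rule sum_norm_le) (use L that in auto)
  with neg cont show ?thesis by blast
qed

end


section \<open>Convergence of the Bernstein-Szego weights\<close>

lemma abs_norm_square_diff:
  fixes x y :: complex
  shows "\<bar>(norm (x + y))\<^sup>2 - (norm x)\<^sup>2\<bar> \<le> norm y * (2 * norm x + norm y)"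
proof -
  have "\<bar>norm (x + y) - norm x\<bar> \<le> norm y"
    using norm_triangle_ineq3[of "x + y" x] by simp
  moreover have "\<bar>norm (x + y) + norm x\<bar> \<le> 2 * norm x + norm y"
    using norm_triangle_ineq[of x y] by simp
  ultimately have "\<bar>norm (x + y) - norm x\<bar> * \<bar>norm (x + y) + norm x\<bar> \<le> norm y * (2 * norm x + norm y)"
    by (intro mult_mono) auto
  moreover have "(norm (x + y))\<^sup>2 - (norm x)\<^sup>2 = (norm (x + y) - norm x) * (norm (x + y) + norm x)"
    by (simp add: power2_eq_square algebra_simps)
  ultimately show ?thesis by (simp only: abs_mult)
qed

text \<open>With \<open>c = 1 + t' cnj a\<close>, the quantity \<open>g - t f\<close> is multiplied by \<open>c / r\<close> in each step up to
  an error \<open>E f / r\<close>, and \<open>\<bar>c\<bar>\<^sup>2 / r\<^sup>2\<close> is nearly \<open>(1 - \<bar>t'\<bar>\<^sup>2) / (1 - \<bar>t\<bar>\<^sup>2)\<close>, because \<open>t\<close> is nearly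
  the image of \<open>t'\<close> under an automorphism of the disk.\<close>

lemma riccati_step:
  fixes a t t' z f g F G :: complex and r \<epsilon> :: real
  assumes z: "norm z = 1" and a: "norm a \<le> 1 / 2" and t: "norm t \<le> 1 / 2" and t': "norm t' \<le> 1 / 2"
    and r: "r\<^sup>2 = 1 - (norm a)\<^sup>2" and fg: "norm f = norm g"
    and F: "z * f = r * F + cnj a * g" and G: "g = r * G + a * z * f"
    and E: "norm (t - z * t' - z * a + cnj a * t * t') \<le> \<epsilon>" and \<epsilon>: "\<epsilon> \<le> 1"
  shows "\<bar>(norm (G - t' * F))\<^sup>2 / (1 - (norm t')\<^sup>2) - (norm (g - t * f))\<^sup>2 / (1 - (norm t)\<^sup>2)\<bar> \<le>
     22 * \<epsilon> * ((norm (g - t * f))\<^sup>2 / (1 - (norm t)\<^sup>2))"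
proof -
  define e where "e = t - z * t' - z * a + cnj a * t * t'"
  define c where "c = 1 + t' * cnj a"
  define Y where "Y = g - t * f"
  define Q where "Q = r\<^sup>2 * (1 - (norm t')\<^sup>2)"
  define s where "s = 1 - (norm t)\<^sup>2"
  have e: "norm e \<le> \<epsilon>" using E by (simp add: e_def)
  have \<epsilon>0: "0 \<le> \<epsilon>" using order.trans[OF norm_ge_zero e] .
  have half: "(norm x)\<^sup>2 \<le> 1 / 4" if "norm x \<le> 1 / 2" for x :: complex
    using power_mono[OF that, of 2] by (simp add: power2_eq_square)
  have r0: "r \<noteq> 0" using r half[OF a] by auto
  have s: "3 / 4 \<le> s" "s \<le> 1" using half[OF t] by (auto simp: s_def)
  have Q: "9 / 16 \<le> Q"
    unfolding Q_def using mult_mono[of "3 / 4" "r\<^sup>2" "3 / 4" "1 - (norm t')\<^sup>2"] half[OF a] half[OF t'] r by simp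
  have step: "r * (G - t' * F) = c * Y + e * f"
  proof -
    have "r * (G - t' * F) = g - a * z * f - t' * (z * f - cnj a * g)" using F G by algebra
    thus ?thesis by (simp add: c_def Y_def e_def algebra_simps)
  qed
  have nc: "norm c \<le> 5 / 4"
  proof -
    have "norm (t' * cnj a) \<le> 1 / 2 * (1 / 2)" unfolding norm_mult using a t' by (intro mult_mono) auto
    thus ?thesis unfolding c_def using norm_triangle_ineq[of 1 "t' * cnj a"] by simp
  qed
  \<comment> \<open>As \<open>norm f = norm g\<close> and \<open>norm t \<le> 1 / 2\<close>,
    \<open>norm Y\<close> is at least half of \<open>norm f\<close>.\<close>
  have f: "norm f \<le> 2 * norm Y"
  proof -
    have "norm (t * f) \<le> 1 / 2 * norm f" unfolding norm_mult using t by (intro mult_right_mono) auto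
    thus ?thesis unfolding Y_def using norm_triangle_ineq2[of g "t * f"] fg by simp
  qed
  \<comment> \<open>The constant is \<open>2 * (9 / 2)\<close>, where
    \<open>9 / 2 = 2 * (5 / 4) + 2\<close> bounds the second factor of
    \<open>abs_norm_square_diff\<close> in units of \<open>norm Y\<close>.\<close>
  have d1: "\<bar>(norm (c * Y + e * f))\<^sup>2 - (norm (c * Y))\<^sup>2\<bar> \<le> 9 * \<epsilon> * (norm Y)\<^sup>2"
  proof -
    have ef: "norm (e * f) \<le> \<epsilon> * (2 * norm Y)" unfolding norm_mult using e f \<epsilon>0 by (intro mult_mono) auto
    have "\<epsilon> * (2 * norm Y) \<le> 1 * (2 * norm Y)" using \<epsilon> by (intro mult_right_mono) auto
    hence "norm (e * f) \<le> 2 * norm Y" using ef by simp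
    moreover have "norm (c * Y) \<le> 5 / 4 * norm Y" unfolding norm_mult using nc by (intro mult_right_mono) auto
    ultimately have "2 * norm (c * Y) + norm (e * f) \<le> 9 / 2 * norm Y" by simp
    hence "norm (e * f) * (2 * norm (c * Y) + norm (e * f)) \<le> \<epsilon> * (2 * norm Y) * (9 / 2 * norm Y)"
      using ef \<epsilon>0 by (intro mult_mono) auto
    thus ?thesis using abs_norm_square_diff[of "c * Y" "e * f"] by (simp add: power2_eq_square algebra_simps)
  qed
  \<comment> \<open>\<open>c * t\<close> equals \<open>z * (a + t')\<close> up to \<open>e\<close>,
    so \<open>norm (c * t)\<close> may be replaced by \<open>norm (a + t')\<close>, which is at most
    1; the constant is \<open>2 + 1\<close>.\<close>
  have d2: "\<bar>(norm c)\<^sup>2 * s - Q\<bar> \<le> 3 * \<epsilon>"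
  proof -
    have ct: "c * t = z * (a + t') + e" by (simp add: c_def e_def algebra_simps)
    have "norm (a + t') \<le> 1" using norm_triangle_ineq[of a t'] a t' by simp
    hence "norm e * (2 * norm (z * (a + t')) + norm e) \<le> \<epsilon> * 3"
      using e \<epsilon> \<epsilon>0 z by (intro mult_mono) (auto simp: norm_mult)
    hence "\<bar>(norm (c * t))\<^sup>2 - (norm (a + t'))\<^sup>2\<bar> \<le> 3 * \<epsilon>"
      using abs_norm_square_diff[of "z * (a + t')" e] z unfolding ct by (simp add: norm_mult)
    \<comment> \<open>The identity behind the invariance of the disk under the automorphism with
      numerator \<open>a + t'\<close> and denominator \<open>c\<close>.\<close>
    moreover have "(norm c)\<^sup>2 - (norm (a + t'))\<^sup>2 = Q"
      unfolding Q_def r c_def cmod_power2 by (simp add: algebra_simps power2_eq_square)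
    moreover have "(norm c)\<^sup>2 * s = (norm c)\<^sup>2 - (norm (c * t))\<^sup>2"
      by (simp add: s_def norm_mult power_mult_distrib algebra_simps)
    ultimately show ?thesis by (simp add: abs_minus_commute abs_le_iff)
  qed
  let ?R = "(norm (c * Y + e * f))\<^sup>2" and ?y = "(norm Y)\<^sup>2"
  have W': "(norm (G - t' * F))\<^sup>2 / (1 - (norm t')\<^sup>2) = ?R / Q"
    using r0 by (simp add: step[symmetric] Q_def norm_mult power_mult_distrib)
  have "?R / Q - ?y / s = (?R * s - ?y * Q) / (Q * s)"
    using s Q by (simp add: field_simps)
  also have "?R * s - ?y * Q = (?R - (norm (c * Y))\<^sup>2) * s + ?y * ((norm c)\<^sup>2 * s - Q)"
    by (simp add: norm_mult power_mult_distrib algebra_simps)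
  finally have eq: "?R / Q - ?y / s = ((?R - (norm (c * Y))\<^sup>2) * s + ?y * ((norm c)\<^sup>2 * s - Q)) / (Q * s)" .
  have "\<bar>(?R - (norm (c * Y))\<^sup>2) * s + ?y * ((norm c)\<^sup>2 * s - Q)\<bar> \<le> 9 * \<epsilon> * ?y * 1 + ?y * (3 * \<epsilon>)"
  proof (rule order.trans[OF abs_triangle_ineq add_mono])
    show "\<bar>(?R - (norm (c * Y))\<^sup>2) * s\<bar> \<le> 9 * \<epsilon> * ?y * 1"
      unfolding abs_mult using d1 s \<epsilon>0 by (intro mult_mono) auto
    show "\<bar>?y * ((norm c)\<^sup>2 * s - Q)\<bar> \<le> ?y * (3 * \<epsilon>)"
      unfolding abs_mult using d2 by (intro mult_mono) auto
  qed
  hence "\<bar>?R / Q - ?y / s\<bar> \<le> (12 * \<epsilon> * ?y) / (Q * s)"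
    unfolding eq abs_divide using s Q by (intro frac_le) auto
  also have "\<dots> = (12 / Q) * (\<epsilon> * (?y / s))" by simp
  \<comment> \<open>From \<open>Q \<ge> 9 / 16\<close>, \<open>12 / Q\<close> is at most
    \<open>64 / 3\<close>, which is below 22.\<close>
  also have "\<dots> \<le> 22 * (\<epsilon> * (?y / s))"
    using Q s \<epsilon>0 by (intro mult_right_mono) (auto simp: field_simps)
  finally show ?thesis unfolding W' by (simp add: s_def Y_def)
qed

text \<open>With \<open>h\<close> the relative increment, the quadratic error of
  \<open>ln (1 + h)\<close> is at most \<open>\<bar>h\<bar>\<close> because
  \<open>d \<le> 1 / 2\<close>.\<close>

lemma abs_ln_ratio_le:
  fixes x y :: real
  assumes "x > 0" "y > 0" "\<bar>y - x\<bar> \<le> d * x" "d \<le> 1 / 2"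
  shows "\<bar>ln y - ln x\<bar> \<le> 2 * d"
proof -
  define h where "h = (y - x) / x"
  have h: "\<bar>h\<bar> \<le> d" using assms by (simp add: h_def field_simps)
  have "1 + h = y / x" using assms by (simp add: h_def field_simps)
  hence "ln y - ln x = ln (1 + h)" using assms ln_div[of y x] by simp
  moreover have "\<bar>ln (1 + h) - h\<bar> \<le> 2 * h\<^sup>2"
    using h assms by (intro abs_ln_one_plus_x_minus_x_bound) auto
  moreover have "2 * h\<^sup>2 \<le> \<bar>h\<bar>"
  proof -
    have "2 * h\<^sup>2 = (2 * \<bar>h\<bar>) * \<bar>h\<bar>" by (simp add: power2_eq_square)
    also have "\<dots> \<le> 1 * \<bar>h\<bar>" using h assms by (intro mult_right_mono) auto
    finally show ?thesis by simp
  qed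
  ultimately show ?thesis using h by linarith
qed

section \<open>Uniform limits of the weights on compact sets\<close>

context szego_system
begin

text \<open>By \<open>riccati_step\<close> the increments of \<open>ln (W n z)\<close> are dominated
  by a multiple of \<open>\<epsilon>\<close>, so the logarithm converges uniformly to some
  \<open>L\<close>. The limit weight is \<open>exp (- L z)\<close>, because the ratio of
  \<open>W n z\<close> to the squared modulus of \<open>\<phi> n\<close> tends to 1 with
  \<open>t\<close> tending to 0. The bound \<open>K\<close> serves dominated convergence.\<close>

lemma weights_converge:
  assumes C: "compact C" "C \<subseteq> unit_circle"
    and \<alpha>: "\<alpha> \<longlonglongrightarrow> 0"
    and t_cont: "\<And>n. continuous_on C (t n)"
    and \<tau>: "\<tau> \<longlonglongrightarrow> 0" "\<And>n z. z \<in> C \<Longrightarrow> norm (t n z) \<le> \<tau> n"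
    and \<epsilon>: "summable \<epsilon>" "\<And>n z. z \<in> C \<Longrightarrow>
       norm (t n z - z * t (Suc n) z - z * \<alpha> n + cnj (\<alpha> n) * t n z * t (Suc n) z) \<le> \<epsilon> n"
  shows "\<exists>w N K. continuous_on C w \<and>
     (\<forall>z\<in>C. w z > 0 \<and> (\<lambda>n. 1 / (norm (poly (\<phi> n) z))\<^sup>2) \<longlonglongrightarrow> w z) \<and>
     (\<forall>n\<ge>N. \<forall>z\<in>C. 1 / (norm (poly (\<phi> n) z))\<^sup>2 \<le> K)"
proof -
  define Y where "Y n z = poly (\<psi> n) z - t n z * poly (\<phi> n) z" for n z
  define W where "W n z = (norm (Y n z))\<^sup>2 / (1 - (norm (t n z))\<^sup>2)" for n z
  have zC: "norm z = 1" "z \<in> unit_circle" "z \<noteq> 0" if "z \<in> C" for z using that C by auto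
  have "eventually (\<lambda>n. norm (\<alpha> n) < 1 / 2) sequentially"
    using tendsto_norm_zero[OF \<alpha>] by (rule order_tendstoD) simp
  moreover have "eventually (\<lambda>n. \<tau> n < 1 / 2) sequentially"
    using \<tau>(1) by (rule order_tendstoD) simp
  \<comment> \<open>The threshold gives \<open>22 * \<epsilon> n \<le> 1 / 2\<close>, the condition
    of \<open>abs_ln_ratio_le\<close>.\<close>
  moreover have "eventually (\<lambda>n. \<epsilon> n < 1 / 44) sequentially"
    using summable_LIMSEQ_zero[OF \<epsilon>(1)] by (rule order_tendstoD) simp
  ultimately have "eventually (\<lambda>n. norm (\<alpha> n) < 1 / 2 \<and> \<tau> n < 1 / 2 \<and> \<epsilon> n < 1 / 44) sequentially"
    by eventually_elim auto
  then obtain N where N: "\<And>n. n \<ge> N \<Longrightarrow> norm (\<alpha> n) < 1 / 2 \<and> \<tau> n < 1 / 2 \<and> \<epsilon> n < 1 / 44"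
    by (auto simp: eventually_sequentially)
  have t_half: "norm (t n z) \<le> 1 / 2" if "n \<ge> N" "z \<in> C" for n z
    using \<tau>(2)[OF that(2), of n] N[OF that(1)] by linarith
  have t_sq: "(norm (t n z))\<^sup>2 \<le> 1 / 4" if "n \<ge> N" "z \<in> C" for n z
    using power_mono[OF t_half[OF that], of 2] by (simp add: power2_eq_square)
  have tf: "norm (t n z * poly (\<phi> n) z) \<le> 1 / 2 * norm (poly (\<phi> n) z)" if "n \<ge> N" "z \<in> C" for n z
    unfolding norm_mult using t_half[OF that] by (intro mult_right_mono) auto
  have Ynz: "Y n z \<noteq> 0" if "n \<ge> N" "z \<in> C" for n z
  proof
    assume "Y n z = 0"
    hence "norm (poly (\<psi> n) z) = norm (t n z * poly (\<phi> n) z)" by (simp add: Y_def)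
    thus False using tf[OF that] \<phi>_nonzero_circle[of z n] norm_\<psi>_circle[of z n] zC[OF that(2)] by auto
  qed
  have Wpos: "W n z > 0" if "n \<ge> N" "z \<in> C" for n z
    unfolding W_def using Ynz[OF that] t_sq[OF that] by (intro divide_pos_pos) auto
  have diff: "\<bar>ln (W (Suc n) z) - ln (W n z)\<bar> \<le> 44 * \<epsilon> n" if n: "n \<ge> N" and z: "z \<in> C" for n z
  proof -
    have "\<bar>W (Suc n) z - W n z\<bar> \<le> 22 * \<epsilon> n * W n z"
      unfolding W_def Y_def
      by (rule riccati_step[OF zC(1)[OF z] _ t_half[OF n z] t_half[OF _ z] \<rho>_squared
           norm_\<psi>_circle[OF zC(2)[OF z], symmetric] recursion_\<phi>[OF zC(3)[OF z]] recursion_\<psi>[OF zC(3)[OF z]] \<epsilon>(2)[OF z]])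
         (use N[OF n] n in auto)
    hence "\<bar>ln (W (Suc n) z) - ln (W n z)\<bar> \<le> 2 * (22 * \<epsilon> n)"
      using N[OF n] n z by (intro abs_ln_ratio_le Wpos) auto
    thus ?thesis by simp
  qed
  define D where "D i z = ln (W (Suc (N + i)) z) - ln (W (N + i) z)" for i z
  have lim0: "uniform_limit C (\<lambda>n z. \<Sum>i<n. D i z) (\<lambda>z. \<Sum>i. D i z) sequentially"
  proof (rule Weierstrass_m_test)
    show "norm (D n z) \<le> 44 * \<epsilon> (n + N)" if "z \<in> C" for n z
      using diff[of "N + n" z] that by (simp add: D_def add.commute)
    show "summable (\<lambda>n. 44 * \<epsilon> (n + N))"
      using \<epsilon>(1) by (intro summable_mult) (subst summable_iff_shift)
  qed
  have tele: "(\<Sum>i<n. D i z) = ln (W (N + n) z) - ln (W N z)" for n z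
    by (induction n) (auto simp: D_def)
  define L where "L z = ln (W N z) + (\<Sum>i. D i z)" for z
  have W_cont: "continuous_on C (W n)" if "n \<ge> N" for n
    unfolding W_def[abs_def] Y_def using t_sq[OF that]
    by (intro continuous_intros t_cont) force
  have lnW_cont: "continuous_on C (\<lambda>z. ln (W n z))" if "n \<ge> N" for n
    by (intro continuous_on_ln W_cont that) (use Wpos[OF that] in force)
  have "continuous_on C (\<lambda>z. \<Sum>i. D i z)"
  proof (rule uniform_limit_theorem[OF _ lim0])
    show "\<forall>\<^sub>F n in sequentially. continuous_on C (\<lambda>z. \<Sum>i<n. D i z)"
      unfolding tele by (intro always_eventually allI continuous_intros lnW_cont) auto
  qed simp
  hence L_cont: "continuous_on C L" unfolding L_def by (intro continuous_intros lnW_cont) auto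
  have "bounded (L ` C)"
    using compact_continuous_image[OF L_cont C(1)] by (rule compact_imp_bounded)
  then obtain b where b: "\<And>z. z \<in> C \<Longrightarrow> \<bar>L z\<bar> \<le> b" by (auto simp: bounded_iff)
  have "\<forall>\<^sub>F n in sequentially. \<forall>z\<in>C. dist (\<Sum>i<n. D i z) (\<Sum>i. D i z) < 1"
    using lim0 by (rule uniform_limitD) simp
  then obtain N' where N': "\<And>n z. n \<ge> N' \<Longrightarrow> z \<in> C \<Longrightarrow> dist (\<Sum>i<n. D i z) (\<Sum>i. D i z) < 1"
    by (auto simp: eventually_sequentially)
  have bound: "1 / (norm (poly (\<phi> n) z))\<^sup>2 \<le> 3 * exp (b + 1)" if n: "n \<ge> N + N'" and z: "z \<in> C" for n z
  proof -
    have n': "n \<ge> N" using n by simp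
    have "dist (ln (W n z)) (L z) < 1"
      using N'[of "n - N" z] n z by (simp add: tele L_def dist_real_def algebra_simps)
    hence "- b - 1 \<le> ln (W n z)" using b[OF z] by (simp add: dist_real_def abs_le_iff) linarith
    hence "exp (- b - 1) \<le> W n z" using Wpos[OF n' z] by (simp add: ln_ge_iff)
    \<comment> \<open>The constant is \<open>(3 / 2)\<^sup>2 / (3 / 4)\<close>.\<close>
    moreover have "W n z \<le> 3 * (norm (poly (\<phi> n) z))\<^sup>2"
    proof -
      have "norm (Y n z) \<le> 3 / 2 * norm (poly (\<phi> n) z)"
        unfolding Y_def using norm_triangle_ineq4[of "poly (\<psi> n) z" "t n z * poly (\<phi> n) z"] tf[OF n' z]
          norm_\<psi>_circle[OF zC(2)[OF z], of n] by simp
      hence "(norm (Y n z))\<^sup>2 \<le> 9 / 4 * (norm (poly (\<phi> n) z))\<^sup>2"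
        using power_mono[of "norm (Y n z)" "3 / 2 * norm (poly (\<phi> n) z)" 2] by (simp add: power_mult_distrib power2_eq_square)
      hence "W n z \<le> (9 / 4 * (norm (poly (\<phi> n) z))\<^sup>2) / (3 / 4)"
        unfolding W_def using t_sq[OF n' z] by (intro frac_le) auto
      thus ?thesis by simp
    qed
    ultimately have "exp (- b - 1) \<le> 3 * (norm (poly (\<phi> n) z))\<^sup>2" by simp
    moreover have "exp (- b - 1) = 1 / exp (b + 1)" by (simp add: exp_minus[symmetric] inverse_eq_divide[symmetric])
    ultimately show ?thesis using \<phi>_nonzero_circle[OF zC(2)[OF z], of n] by (simp add: field_simps)
  qed
  have lim: "(\<lambda>n. 1 / (norm (poly (\<phi> n) z))\<^sup>2) \<longlonglongrightarrow> exp (- L z)" if z: "z \<in> C" for z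
  proof -
    have "(\<lambda>n. \<Sum>i<n. D i z) \<longlonglongrightarrow> (\<Sum>i. D i z)" by (rule tendsto_uniform_limitI[OF lim0 z])
    hence "(\<lambda>n. ln (W N z) + (\<Sum>i<n. D i z)) \<longlonglongrightarrow> L z" unfolding L_def by (intro tendsto_intros)
    hence "(\<lambda>n. ln (W (n + N) z)) \<longlonglongrightarrow> L z" by (simp add: tele add.commute)
    hence lnW: "(\<lambda>n. ln (W n z)) \<longlonglongrightarrow> L z" by (rule LIMSEQ_offset)
    have t0: "(\<lambda>n. t n z) \<longlonglongrightarrow> 0"
      by (rule Lim_null_comparison[OF _ \<tau>(1)]) (use \<tau>(2)[OF z] in auto)
    have "(\<lambda>n. t n z * (poly (\<phi> n) z / poly (\<psi> n) z)) \<longlonglongrightarrow> 0"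
    proof (rule Lim_null_comparison[OF _ \<tau>(1)], rule always_eventually, rule allI)
      fix n
      show "norm (t n z * (poly (\<phi> n) z / poly (\<psi> n) z)) \<le> \<tau> n"
        using \<tau>(2)[OF z, of n] norm_\<psi>_circle[OF zC(2)[OF z], of n] \<phi>_nonzero_circle[OF zC(2)[OF z], of n]
        by (simp add: norm_mult norm_divide)
    qed
    \<comment> \<open>The weight, from index \<open>N\<close> on, written with factors of known
      limit: \<open>\<psi> n\<close> and \<open>\<phi> n\<close> have equal modulus on the circle,
      so the fraction is \<open>W n z\<close> divided by the squared modulus of
      \<open>\<phi> n\<close>.\<close>
    hence l1: "(\<lambda>n. (norm (1 - t n z * (poly (\<phi> n) z / poly (\<psi> n) z)))\<^sup>2 / (1 - (norm (t n z))\<^sup>2) * exp (- ln (W n z)))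
        \<longlonglongrightarrow> (norm (1 - 0 :: complex))\<^sup>2 / (1 - (norm (0 :: complex))\<^sup>2) * exp (- L z)"
      by (intro tendsto_intros t0 lnW) auto
    have l2: "\<forall>\<^sub>F n in sequentially. (norm (1 - t n z * (poly (\<phi> n) z / poly (\<psi> n) z)))\<^sup>2 / (1 - (norm (t n z))\<^sup>2) * exp (- ln (W n z)) =
        1 / (norm (poly (\<phi> n) z))\<^sup>2"
      using eventually_ge_at_top[of N]
    proof eventually_elim
      case (elim n)
      have nz: "poly (\<psi> n) z \<noteq> 0" using \<psi>_nonzero[of z n] zC(1)[OF z] by simp
      have Y: "norm (Y n z) = norm (poly (\<phi> n) z) * norm (1 - t n z * (poly (\<phi> n) z / poly (\<psi> n) z))"
      proof -
        have "Y n z = poly (\<psi> n) z * (1 - t n z * (poly (\<phi> n) z / poly (\<psi> n) z))"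
          using nz by (simp add: Y_def field_simps)
        thus ?thesis using norm_\<psi>_circle[OF zC(2)[OF z], of n] by (simp add: norm_mult)
      qed
      have s: "1 - (norm (t n z))\<^sup>2 \<noteq> 0" using t_sq[OF elim z] by simp
      have u: "norm (1 - t n z * (poly (\<phi> n) z / poly (\<psi> n) z)) \<noteq> 0" "norm (poly (\<phi> n) z) \<noteq> 0"
        using Ynz[OF elim z] Y by auto
      have inv: "exp (- ln (W n z)) = 1 / W n z"
        using Wpos[OF elim z] by (simp add: exp_minus inverse_eq_divide)
      have gen: "v\<^sup>2 / x * (1 / ((p * v)\<^sup>2 / x)) = 1 / p\<^sup>2" if "x \<noteq> 0" "v \<noteq> 0" "p \<noteq> 0" for x v p :: real
        using that by (simp add: power_mult_distrib)
      show ?case unfolding inv unfolding W_def Y by (rule gen[OF s u])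
    qed
    show ?thesis using Lim_transform_eventually[OF l1 l2] by simp
  qed
  show ?thesis
    by (intro exI[of _ "\<lambda>z. exp (- L z)"] exI[of _ "N + N'"] exI[of _ "3 * exp (b + 1)"])
       (use lim bound L_cont in \<open>auto intro!: continuous_intros\<close>)
qed

end


section \<open>The singular part\<close>

text \<open>Components whose angles give the same point of the circle are added. Rotated bounded
  variation survives because they share the rotation, and \<open>ell_components\<close> passes the
  \<open>ell\<close> condition from \<open>\<alpha>\<close> to these sums.\<close>

lemma gbv_system_exists:
  assumes A: "finite A" and \<alpha>: "\<alpha> \<in> ell (2 * q + 1) \<inter> GBV 0 A"
  shows "\<exists>\<beta>. gbv_system A \<beta> \<alpha> q"
proof -
  from \<alpha> obtain b where b: "\<And>\<phi>. \<phi> \<in> A \<Longrightarrow> rotated_bv 0 \<phi> (b \<phi>)" "\<And>n. \<alpha> n = (\<Sum>\<phi>\<in>A. b \<phi> n)"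
    by (auto simp: GBV_def)
  define \<beta> where "\<beta> \<omega> n = (\<Sum>x | x \<in> A \<and> cis x = \<omega>. b x n)" for \<omega> n
  have sum_\<beta>: "\<alpha> n = (\<Sum>\<omega>\<in>cis ` A. \<beta> \<omega> n)" for n
    unfolding b(2) \<beta>_def by (rule sum.image_gen[OF A])
  have rot: "summable (\<lambda>n. norm (\<omega> * \<beta> \<omega> (Suc n) - \<beta> \<omega> n))" for \<omega>
  proof (rule summable_comparison_test)
    show "summable (\<lambda>n. \<Sum>x | x \<in> A \<and> cis x = \<omega>. norm (cis x * b x (Suc n) - b x n))"
      using b(1) by (intro summable_sum) (auto simp: rotated_bv_def)
    have "norm (\<omega> * \<beta> \<omega> (Suc n) - \<beta> \<omega> n) \<le> (\<Sum>x | x \<in> A \<and> cis x = \<omega>. norm (cis x * b x (Suc n) - b x n))" for n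
    proof -
      have "\<omega> * \<beta> \<omega> (Suc n) - \<beta> \<omega> n = (\<Sum>x | x \<in> A \<and> cis x = \<omega>. cis x * b x (Suc n) - b x n)"
        unfolding \<beta>_def sum_distrib_left sum_subtractf by (intro arg_cong2[where f = minus] sum.cong) auto
      thus ?thesis using norm_sum by metis
    qed
    thus "\<exists>N. \<forall>n\<ge>N. norm (norm (\<omega> * \<beta> \<omega> (Suc n) - \<beta> \<omega> n)) \<le>
        (\<Sum>x | x \<in> A \<and> cis x = \<omega>. norm (cis x * b x (Suc n) - b x n))" by simp
  qed
  have "\<beta> \<omega> \<in> ell (2 * q + 1)" if "\<omega> \<in> cis ` A" for \<omega>
  proof (rule ell_components[OF _ _ _ rot _ that])
    show "(\<lambda>n. \<Sum>\<omega>\<in>cis ` A. \<beta> \<omega> n) \<in> ell (2 * q + 1)" using \<alpha> sum_\<beta>[symmetric] by simp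
  qed (use A in auto)
  thus ?thesis using A rot sum_\<beta> unfolding gbv_system_def by blast
qed

lemma (in gbv_system) \<alpha>_tendsto_0: "\<alpha> \<longlonglongrightarrow> 0"
proof (rule Lim_null_comparison[OF _ B_tendsto_0], rule always_eventually, rule allI)
  show "norm (\<alpha> n) \<le> B n" for n unfolding \<alpha>_eq B_def by (rule norm_sum)
qed

lemma continuous_on_infdist_cutoff: "continuous_on T (\<lambda>z. min 1 (max 0 (k * infdist z F - 1)))"
  for k :: real
  by (intro continuous_intros)

section \<open>From convergent weights to the measure\<close>

context szego_measure
begin

lemma space_\<mu>: "space \<mu> = unit_circle"
  using sets_eq_imp_space_eq[OF sets_\<mu>] by (simp add: space_restrict_space)

text \<open>Compares two limits of the integrals against \<open>bs_measure\<close>: weak convergence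
  to \<open>\<mu>\<close>, and dominated convergence to the weight \<open>w\<close>. As
  \<open>f\<close> vanishes off \<open>C\<close>, control on \<open>C\<close> suffices.\<close>

lemma integral_eq_of_weights_converge:
  fixes f w :: "complex \<Rightarrow> real"
  assumes f: "continuous_on unit_circle f" "\<And>z. z \<in> unit_circle - C \<Longrightarrow> f z = 0"
    "\<And>z. z \<in> unit_circle \<Longrightarrow> 0 \<le> f z \<and> f z \<le> 1"
    and w: "w \<in> borel_measurable circle_borel"
      "\<And>z. z \<in> C \<Longrightarrow> w z \<ge> 0 \<and> (\<lambda>n. 1 / (norm (poly (\<phi> n) z))\<^sup>2) \<longlonglongrightarrow> w z"
      "\<And>n z. n \<ge> N \<Longrightarrow> z \<in> C \<Longrightarrow> 1 / (norm (poly (\<phi> n) z))\<^sup>2 \<le> K"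
  shows "(\<integral>\<^sup>+z. ennreal (f z) \<partial>\<mu>) = (\<integral>\<^sup>+z. ennreal (w z) * ennreal (f z) \<partial>arc_measure)"
proof -
  interpret \<mu>: prob_space \<mu> by (rule prob_\<mu>)
  have fm: "f \<in> borel_measurable arc_measure"
    unfolding measurable_cong_sets[OF sets_arc_measure refl] by (rule borel_measurable_circle_continuous[OF f(1)])
  have wm: "w \<in> borel_measurable arc_measure"
    unfolding measurable_cong_sets[OF sets_arc_measure refl] by (rule w)
  let ?s = "\<lambda>n z. 1 / (norm (poly (\<phi> (n + N)) z))\<^sup>2 * f z"
  have sm: "?s n \<in> borel_measurable arc_measure" for n
    by (intro borel_measurable_times measurable_weight fm)
  have limae: "AE z in arc_measure. (\<lambda>n. ?s n z) \<longlonglongrightarrow> w z * f z"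
  proof (rule AE_I2)
    fix z assume "z \<in> space arc_measure"
    hence z: "z \<in> unit_circle" by simp
    show "(\<lambda>n. ?s n z) \<longlonglongrightarrow> w z * f z"
    proof (cases "z \<in> C")
      case True
      have "(\<lambda>n. 1 / (norm (poly (\<phi> n) z))\<^sup>2) \<longlonglongrightarrow> w z" using w(2)[OF True] by blast
      hence "(\<lambda>n. 1 / (norm (poly (\<phi> (n + N)) z))\<^sup>2) \<longlonglongrightarrow> w z" by (rule LIMSEQ_ignore_initial_segment)
      thus ?thesis by (intro tendsto_intros)
    next
      case False
      thus ?thesis using f(2) z by simp
    qed
  qed
  \<comment> \<open>The absolute value covers empty \<open>C\<close>, for which the hypotheses allow
    a negative \<open>K\<close>.\<close>
  have bdae: "AE z in arc_measure. norm (?s n z) \<le> \<bar>K\<bar>" for n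
  proof (rule AE_I2)
    fix z assume "z \<in> space arc_measure"
    hence z: "z \<in> unit_circle" by simp
    show "norm (?s n z) \<le> \<bar>K\<bar>"
    proof (cases "z \<in> C")
      case True
      have "1 / (norm (poly (\<phi> (n + N)) z))\<^sup>2 \<le> \<bar>K\<bar>" using w(3)[of "n + N" z] True by simp
      hence "1 / (norm (poly (\<phi> (n + N)) z))\<^sup>2 * f z \<le> \<bar>K\<bar> * 1"
        using f(3)[OF z] by (intro mult_mono) auto
      thus ?thesis using f(3)[OF z] by simp
    next
      case False
      thus ?thesis using f(2) z by simp
    qed
  qed
  have int: "integrable arc_measure (\<lambda>z. w z * f z)"
    by (rule integrable_dominated_convergence[OF _ sm _ limae bdae]) (use fm wm in auto)
  have "(\<lambda>n. LINT z|arc_measure. ?s n z) \<longlonglongrightarrow> (LINT z|arc_measure. w z * f z)"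
    by (rule integral_dominated_convergence[OF _ sm _ limae bdae]) (use fm wm in auto)
  moreover have "(LINT z|bs_measure (n + N). f z) = (LINT z|arc_measure. ?s n z)" for n
    using integral_bs_measure[OF f(1)] by simp
  moreover have "(\<lambda>n. LINT z|bs_measure (n + N). f z) \<longlonglongrightarrow> (LINT z|\<mu>. f z)"
    by (rule LIMSEQ_ignore_initial_segment[OF bs_measure_weak_conv[OF f(1)]])
  ultimately have eq: "(LINT z|\<mu>. f z) = (LINT z|arc_measure. w z * f z)"
    using LIMSEQ_unique by simp
  have nonneg: "0 \<le> w z * f z" if "z \<in> unit_circle" for z
    using w(2)[of z] f(2)[of z] f(3)[OF that] that by (cases "z \<in> C") auto
  have "(\<integral>\<^sup>+z. ennreal (f z) \<partial>\<mu>) = ennreal (LINT z|\<mu>. f z)"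
    by (intro nn_integral_eq_integral integrable_circle_continuous \<mu>.finite_measure_axioms sets_\<mu> f(1))
       (use f(3) space_\<mu> in auto)
  also have "\<dots> = (\<integral>\<^sup>+z. ennreal (w z * f z) \<partial>arc_measure)"
    unfolding eq by (intro nn_integral_eq_integral[symmetric] int) (use nonneg in auto)
  also have "\<dots> = (\<integral>\<^sup>+z. ennreal (w z) * ennreal (f z) \<partial>arc_measure)"
  proof (rule nn_integral_cong)
    fix z assume "z \<in> space arc_measure"
    hence z: "z \<in> unit_circle" by simp
    show "ennreal (w z * f z) = ennreal (w z) * ennreal (f z)"
      using f(2)[of z] f(3)[OF z] z w(2)[of z] by (cases "z \<in> C") (auto simp: ennreal_mult)
  qed
  finally show ?thesis .
qed

text \<open>Monotone convergence along continuous cutoffs, each vanishing on the circle off a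
  compact subset of \<open>Op\<close>, so that \<open>integral_eq_of_weights_converge\<close>
  applies to it.\<close>

lemma emeasure_open_of_weights_converge:
  assumes Op: "open Op"
    and w: "w \<in> borel_measurable circle_borel"
    and conv: "\<And>C. compact C \<Longrightarrow> C \<subseteq> unit_circle \<inter> Op \<Longrightarrow> \<exists>N K.
       (\<forall>z\<in>C. w z \<ge> 0 \<and> (\<lambda>n. 1 / (norm (poly (\<phi> n) z))\<^sup>2) \<longlonglongrightarrow> w z) \<and>
       (\<forall>n\<ge>N. \<forall>z\<in>C. 1 / (norm (poly (\<phi> n) z))\<^sup>2 \<le> K)"
  shows "(\<integral>\<^sup>+z. indicator Op z \<partial>\<mu>) = (\<integral>\<^sup>+z. ennreal (w z) * indicator Op z \<partial>arc_measure)"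
proof -
  \<comment> \<open>The point \<open>2\<close> makes \<open>F\<close> nonempty, as \<open>infdist\<close> is \<open>0\<close> for the empty set.\<close>
  define F where "F = insert 2 (- Op)"
  have F: "closed F" "F \<noteq> {}" using Op by (auto simp: F_def intro!: closed_insert)
  have FU: "z \<in> F \<longleftrightarrow> z \<notin> Op" if "z \<in> unit_circle" for z
    using that by (auto simp: F_def)
  \<comment> \<open>For \<open>k > 0\<close> the cutoff is 0 up to distance \<open>1 / k\<close>
    from \<open>F\<close> and 1 from distance \<open>2 / k\<close> on; it increases to the indicator
    of the complement of \<open>F\<close>.\<close>
  define f where "f k z = min 1 (max 0 (real k * infdist z F - 1))" for k :: nat and z :: complex
  have fc: "continuous_on T (f k)" for T k
    unfolding f_def by (rule continuous_on_infdist_cutoff)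
  have f01: "0 \<le> f k z \<and> f k z \<le> 1" for k z by (auto simp: f_def)
  have finc: "f k z \<le> f l z" if "k \<le> l" for k l z
    unfolding f_def using that infdist_nonneg[of z F] by (intro min.mono max.mono diff_mono mult_right_mono) auto
  have flim: "(\<lambda>k. ennreal (f k z)) \<longlonglongrightarrow> indicator (- F) z" for z
  proof (cases "z \<in> - F")
    case True
    hence "infdist z F \<noteq> 0" using F in_closed_iff_infdist_zero by blast
    hence pos: "infdist z F > 0" using infdist_nonneg[of z F] by simp
    obtain k0 :: nat where k0: "2 < real k0 * infdist z F" using reals_Archimedean3[OF pos] by blast
    have "f k z = 1" if "k \<ge> k0" for k
    proof -
      have "real k0 * infdist z F \<le> real k * infdist z F" using that pos by (intro mult_right_mono) auto
      thus ?thesis using k0 by (simp add: f_def)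
    qed
    hence "\<forall>\<^sub>F k in sequentially. ennreal (f k z) = 1" by (auto simp: eventually_sequentially)
    thus ?thesis using True by (simp add: tendsto_eventually)
  next
    case False
    hence "infdist z F = 0" by simp
    thus ?thesis using False by (simp add: f_def)
  qed
  have eq: "(\<integral>\<^sup>+z. ennreal (f k z) \<partial>\<mu>) = (\<integral>\<^sup>+z. ennreal (w z) * ennreal (f k z) \<partial>arc_measure)" for k
  proof -
    define C where "C = unit_circle \<inter> {z. 1 \<le> real k * infdist z F}"
    have "closed {z. 1 \<le> real k * infdist z F}" by (intro closed_Collect_le continuous_intros)
    hence "compact C" unfolding C_def by (intro compact_Int_closed) auto
    moreover have "C \<subseteq> unit_circle \<inter> Op"
    proof
      fix z assume z: "z \<in> C"
      hence "infdist z F \<noteq> 0" by (auto simp: C_def)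
      hence "z \<notin> F" by auto
      thus "z \<in> unit_circle \<inter> Op" using z FU[of z] by (auto simp: C_def)
    qed
    ultimately obtain N K where NK: "\<And>z. z \<in> C \<Longrightarrow> w z \<ge> 0 \<and> (\<lambda>n. 1 / (norm (poly (\<phi> n) z))\<^sup>2) \<longlonglongrightarrow> w z"
       "\<And>n z. n \<ge> N \<Longrightarrow> z \<in> C \<Longrightarrow> 1 / (norm (poly (\<phi> n) z))\<^sup>2 \<le> K"
      using conv[of C] by blast
    show ?thesis
    proof (rule integral_eq_of_weights_converge[where C = C and N = N and K = K, OF fc _ f01 w])
      show "f k z = 0" if "z \<in> unit_circle - C" for z
        using that by (auto simp: C_def f_def)
    qed (fact NK)+
  qed
  have fm: "(\<lambda>z. ennreal (f k z)) \<in> borel_measurable circle_borel" for k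
    using borel_measurable_circle_continuous[OF fc[of unit_circle k]] by simp
  have fm1: "(\<lambda>z. ennreal (f k z)) \<in> borel_measurable \<mu>" for k
    unfolding measurable_cong_sets[OF sets_\<mu> refl] by (rule fm)
  have fm2: "(\<lambda>z. ennreal (w z) * ennreal (f k z)) \<in> borel_measurable arc_measure" for k
    unfolding measurable_cong_sets[OF sets_arc_measure refl]
    by (intro borel_measurable_times_ennreal fm measurable_compose[OF w measurable_ennreal])
  have "(\<lambda>k. \<integral>\<^sup>+z. ennreal (f k z) \<partial>\<mu>) \<longlonglongrightarrow> (\<integral>\<^sup>+z. indicator (- F) z \<partial>\<mu>)"
    by (intro nn_integral_LIMSEQ fm1) (auto simp: incseq_def le_fun_def intro!: flim ennreal_leI finc)
  moreover have "(\<lambda>k. \<integral>\<^sup>+z. ennreal (w z) * ennreal (f k z) \<partial>arc_measure) \<longlonglongrightarrow> (\<integral>\<^sup>+z. ennreal (w z) * indicator (- F) z \<partial>arc_measure)"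
    by (intro nn_integral_LIMSEQ fm2)
       (auto simp: incseq_def le_fun_def intro!: ennreal_tendsto_cmult flim ennreal_leI finc mult_left_mono)
  ultimately have "(\<integral>\<^sup>+z. indicator (- F) z \<partial>\<mu>) = (\<integral>\<^sup>+z. ennreal (w z) * indicator (- F) z \<partial>arc_measure)"
    unfolding eq by (rule LIMSEQ_unique)
  moreover have "indicator (- F) z = (indicator Op z :: ennreal)" if "z \<in> unit_circle" for z
    using FU[OF that] by (auto simp: indicator_def)
  ultimately show ?thesis by (simp add: space_\<mu> cong: nn_integral_cong_simp)
qed

text \<open>Both sides are finite and agree on open sets, an intersection-stable generator of the
  Borel sets.\<close>

lemma density_eq_of_weights_converge:
  assumes U: "open U"
    and w: "w \<in> borel_measurable circle_borel"
    and conv: "\<And>C. compact C \<Longrightarrow> C \<subseteq> unit_circle \<inter> U \<Longrightarrow> \<exists>N K.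
       (\<forall>z\<in>C. w z \<ge> 0 \<and> (\<lambda>n. 1 / (norm (poly (\<phi> n) z))\<^sup>2) \<longlonglongrightarrow> w z) \<and>
       (\<forall>n\<ge>N. \<forall>z\<in>C. 1 / (norm (poly (\<phi> n) z))\<^sup>2 \<le> K)"
  shows "density \<mu> (indicator U) = density arc_measure (\<lambda>z. ennreal (w z) * indicator U z)"
    (is "?M1 = ?M2")
proof -
  interpret \<mu>: prob_space \<mu> by (rule prob_\<mu>)
  have Um: "unit_circle \<inter> T \<in> sets circle_borel" if "open T" for T
    using that by (auto simp: sets_restrict_space)
  have im: "(indicator T :: complex \<Rightarrow> ennreal) \<in> borel_measurable circle_borel" if "open T" for T
    by (rule measurable_restrict_space1) (use that in simp)
  have im1: "(indicator U :: complex \<Rightarrow> ennreal) \<in> borel_measurable \<mu>"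
    unfolding measurable_cong_sets[OF sets_\<mu> refl] by (rule im[OF U])
  have im2: "(\<lambda>z. ennreal (w z) * indicator U z) \<in> borel_measurable arc_measure"
    unfolding measurable_cong_sets[OF sets_arc_measure refl]
    by (intro borel_measurable_times_ennreal im U measurable_compose[OF w measurable_ennreal])
  have id: "(\<lambda>z. z) \<in> measurable circle_borel borel" by (rule measurable_restrict_space1) simp
  have id1: "(\<lambda>z. z) \<in> measurable ?M1 borel" and id2: "(\<lambda>z. z) \<in> measurable ?M2 borel"
    unfolding measurable_cong_sets[OF sets_density refl] measurable_cong_sets[OF sets_\<mu> refl]
      measurable_cong_sets[OF sets_arc_measure refl] by (fact id)+
  have em1: "emeasure (distr ?M1 borel (\<lambda>z. z)) T = emeasure ?M1 (T \<inter> unit_circle)" if "T \<in> sets borel" for T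
    by (subst emeasure_distr[OF id1 that]) (simp add: space_\<mu>)
  have em2: "emeasure (distr ?M2 borel (\<lambda>z. z)) T = emeasure ?M2 (T \<inter> unit_circle)" if "T \<in> sets borel" for T
    by (subst emeasure_distr[OF id2 that]) simp
  have M1: "emeasure ?M1 (T \<inter> unit_circle) = (\<integral>\<^sup>+z. indicator (T \<inter> U) z \<partial>\<mu>)" if "open T" for T
    using im1 Um[OF that] sets_\<mu>
    by (subst emeasure_density) (auto simp: Int_commute space_\<mu> indicator_def intro!: nn_integral_cong)
  have M2: "emeasure ?M2 (T \<inter> unit_circle) = (\<integral>\<^sup>+z. ennreal (w z) * indicator (T \<inter> U) z \<partial>arc_measure)" if "open T" for T
    using im2 Um[OF that]
    by (subst emeasure_density) (auto simp: Int_commute indicator_def intro!: nn_integral_cong)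
  \<comment> \<open>Compared after pushing forward to the plane, where \<open>borel\<close> is
    generated by the open sets; intersecting with the circle leads back.\<close>
  have "distr ?M1 borel (\<lambda>z. z) = distr ?M2 borel (\<lambda>z. z)"
  proof (rule measure_eqI_generator_eq[where E = "{S. open S}" and \<Omega> = UNIV and A = "\<lambda>_. UNIV"])
    show "emeasure (distr ?M1 borel (\<lambda>z. z)) X = emeasure (distr ?M2 borel (\<lambda>z. z)) X" if "X \<in> {S. open S}" for X
    proof -
      have X: "open X" "X \<in> sets borel" using that by auto
      have "(\<integral>\<^sup>+z. indicator (X \<inter> U) z \<partial>\<mu>) = (\<integral>\<^sup>+z. ennreal (w z) * indicator (X \<inter> U) z \<partial>arc_measure)"
        by (rule emeasure_open_of_weights_converge[OF open_Int[OF X(1) U] w conv]) auto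
      thus ?thesis by (simp only: em1[OF X(2)] em2[OF X(2)] M1[OF X(1)] M2[OF X(1)])
    qed
    show "emeasure (distr ?M1 borel (\<lambda>z. z)) UNIV \<noteq> \<infinity>"
    proof -
      have "emeasure (distr ?M1 borel (\<lambda>z. z)) UNIV = (\<integral>\<^sup>+z. indicator U z \<partial>\<mu>)"
        using em1[of UNIV] M1[of UNIV] by simp
      also have "\<dots> \<le> (\<integral>\<^sup>+z. 1 \<partial>\<mu>)" by (intro nn_integral_mono) (auto simp: indicator_def)
      also have "\<dots> = 1" by (simp add: \<mu>.emeasure_space_1)
      finally show ?thesis by (metis ennreal_one_less_top infinity_ennreal_def leD)
    qed
  qed (auto simp: Int_stable_def borel_def)
  hence eq: "emeasure ?M1 (T \<inter> unit_circle) = emeasure ?M2 (T \<inter> unit_circle)" if "T \<in> sets borel" for T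
    using em1[OF that] em2[OF that] by simp
  show ?thesis
  proof (rule measure_eqI)
    fix T assume "T \<in> sets ?M1"
    hence "T \<in> sets circle_borel" by (simp add: sets_\<mu>)
    then obtain T' where "T' \<in> sets borel" "T = T' \<inter> unit_circle" by (auto simp: sets_restrict_space)
    thus "emeasure ?M1 T = emeasure ?M2 T" using eq by simp
  qed (simp add: sets_\<mu>)
qed

section \<open>The limit weight off the exceptional set\<close>

lemma weights_converge_gbv:
  assumes "gbv_system A \<beta> \<alpha> q" "compact C" "C \<subseteq> unit_circle - exceptional_set q A"
  shows "\<exists>w N K. continuous_on C w \<and>
     (\<forall>z\<in>C. w z > 0 \<and> (\<lambda>n. 1 / (norm (poly (\<phi> n) z))\<^sup>2) \<longlonglongrightarrow> w z) \<and>
     (\<forall>n\<ge>N. \<forall>z\<in>C. 1 / (norm (poly (\<phi> n) z))\<^sup>2 \<le> K)"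
proof -
  interpret gbv_system_compact A \<beta> \<alpha> q C
    using assms by (simp add: gbv_system_compact_def gbv_system_compact_axioms_def)
  obtain t K where t: "\<And>n. continuous_on C (t n)" "\<And>n z. z \<in> C \<Longrightarrow> norm (t n z) \<le> K * B n"
    "negligible (\<lambda>n z. t n z - z * t (Suc n) z - z * \<alpha> n + cnj (\<alpha> n) * t n z * t (Suc n) z)"
    using riccati_approx_solution by blast
  obtain \<epsilon> where \<epsilon>: "summable \<epsilon>" "\<And>n z. z \<in> C \<Longrightarrow>
      norm (t n z - z * t (Suc n) z - z * \<alpha> n + cnj (\<alpha> n) * t n z * t (Suc n) z) \<le> \<epsilon> n"
    using t(3) by (auto simp: negligible_def)
  have KB: "(\<lambda>n. K * B n) \<longlonglongrightarrow> 0" using tendsto_mult_right_zero[OF B_tendsto_0] .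
  show ?thesis
    by (rule weights_converge[OF compact_C _ \<alpha>_tendsto_0 t(1) KB t(2) \<epsilon>]) (use C_circle in auto)
qed

text \<open>One global function in place of the limits on single compact sets, which thereby glue
  together.\<close>

definition limit_weight :: "complex \<Rightarrow> real" where
  "limit_weight z = lim (\<lambda>n. 1 / (norm (poly (\<phi> n) z))\<^sup>2)"

lemma limit_weight_measurable: "limit_weight \<in> borel_measurable circle_borel"
proof -
  have "(\<lambda>z. 1 / (norm (poly (\<phi> n) z))\<^sup>2) \<in> borel_measurable circle_borel" for n
    by (rule borel_measurable_circle_continuous[OF continuous_weight])
  thus ?thesis unfolding limit_weight_def[abs_def] by (rule borel_measurable_lim_metric)
qed

lemma limit_weight_compact:
  assumes "gbv_system A \<beta> \<alpha> q" "compact C" "C \<subseteq> unit_circle - exceptional_set q A"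
  shows "continuous_on C limit_weight"
    and "\<exists>N K. (\<forall>z\<in>C. limit_weight z > 0 \<and> (\<lambda>n. 1 / (norm (poly (\<phi> n) z))\<^sup>2) \<longlonglongrightarrow> limit_weight z) \<and>
     (\<forall>n\<ge>N. \<forall>z\<in>C. 1 / (norm (poly (\<phi> n) z))\<^sup>2 \<le> K)"
proof -
  obtain w N K where w: "continuous_on C w" 
     "\<And>z. z \<in> C \<Longrightarrow> w z > 0 \<and> (\<lambda>n. 1 / (norm (poly (\<phi> n) z))\<^sup>2) \<longlonglongrightarrow> w z"
     "\<forall>n\<ge>N. \<forall>z\<in>C. 1 / (norm (poly (\<phi> n) z))\<^sup>2 \<le> K"
    using weights_converge_gbv[OF assms] by blast
  have eq: "limit_weight z = w z" if "z \<in> C" for z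
    unfolding limit_weight_def using w(2)[OF that] by (blast intro: limI)
  show "continuous_on C limit_weight" using w(1) eq by (simp cong: continuous_on_cong)
  show "\<exists>N K. (\<forall>z\<in>C. limit_weight z > 0 \<and> (\<lambda>n. 1 / (norm (poly (\<phi> n) z))\<^sup>2) \<longlonglongrightarrow> limit_weight z) \<and>
     (\<forall>n\<ge>N. \<forall>z\<in>C. 1 / (norm (poly (\<phi> n) z))\<^sup>2 \<le> K)"
    using w(2,3) eq by (intro exI[of _ N] exI[of _ K]) simp
qed

lemma limit_weight_pos:
  assumes "gbv_system A \<beta> \<alpha> q" "z \<in> unit_circle - exceptional_set q A"
  shows "limit_weight z > 0"
  using limit_weight_compact(2)[OF assms(1), of "{z}"] assms(2) by auto

text \<open>Continuity is local, and a small closed ball around \<open>z\<close> misses the finite,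
  hence closed, exceptional set.\<close>

lemma limit_weight_continuous:
  assumes A: "gbv_system A \<beta> \<alpha> q"
  shows "continuous_on (unit_circle - exceptional_set q A) limit_weight"
  unfolding continuous_on_eq_continuous_within
proof
  let ?U = "unit_circle - exceptional_set q A"
  fix z assume z: "z \<in> ?U"
  have "open (- exceptional_set q A)"
    by (intro open_Compl finite_imp_closed finite_exceptional_set gbv_system.finite_A[OF A])
  then obtain e where e: "e > 0" "cball z e \<subseteq> - exceptional_set q A"
    using z open_contains_cball by blast
  have "continuous_on (unit_circle \<inter> cball z e) limit_weight"
    by (rule limit_weight_compact(1)[OF A]) (use e in auto)
  hence "continuous (at z within unit_circle \<inter> cball z e) limit_weight"
    using z e(1) by (auto simp: continuous_on_eq_continuous_within)
  moreover have "at z within ?U = at z within unit_circle \<inter> cball z e"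
  proof (rule at_within_nhd)
    show "z \<in> ball z e" "open (ball z e)" using e(1) by auto
    show "?U \<inter> ball z e - {z} = unit_circle \<inter> cball z e \<inter> ball z e - {z}"
      using e(2) ball_subset_cball[of z e] by blast
  qed
  ultimately show "continuous (at z within ?U) limit_weight" by simp
qed

lemma density_limit_weight:
  assumes A: "gbv_system A \<beta> \<alpha> q"
  shows "density \<mu> (indicator (- exceptional_set q A)) =
    density arc_measure (\<lambda>z. ennreal (limit_weight z) * indicator (- exceptional_set q A) z)"
proof (rule density_eq_of_weights_converge[OF _ limit_weight_measurable])
  show "open (- exceptional_set q A)"
    by (intro open_Compl finite_imp_closed finite_exceptional_set gbv_system.finite_A[OF A])
  show "\<exists>N K. (\<forall>z\<in>C. limit_weight z \<ge> 0 \<and> (\<lambda>n. 1 / (norm (poly (\<phi> n) z))\<^sup>2) \<longlonglongrightarrow> limit_weight z) \<and>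
       (\<forall>n\<ge>N. \<forall>z\<in>C. 1 / (norm (poly (\<phi> n) z))\<^sup>2 \<le> K)"
    if "compact C" "C \<subseteq> unit_circle \<inter> - exceptional_set q A" for C
    using limit_weight_compact(2)[OF A that(1)] that(2) less_imp_le
    by (metis Diff_eq)
qed

end

section \<open>Lebesgue decomposition and singular part off a finite set\<close>

lemma exceptional_set_subset_circle: "exceptional_set q A \<subseteq> unit_circle"
  by (auto simp: exceptional_set_def)

text \<open>Off \<open>S\<close> the measure \<open>\<mu>\<close> has a density, so the arc-null set
  \<open>E\<close> that carries \<open>\<mu>s\<close> is null there for \<open>\<mu>\<close>, hence
  also for \<open>\<mu>s\<close>. The second claim is then uniqueness of densities, \<open>S\<close>
  itself being arc-null.\<close>

lemma lebesgue_decomposition_off_finite_set: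
  fixes \<mu> \<mu>s :: "complex measure" and w v :: "complex \<Rightarrow> real"
  assumes \<mu>: "finite_measure \<mu>" "sets \<mu> = sets circle_borel"
    and dec: "lebesgue_decomposition \<mu> w \<mu>s"
    and S: "finite S" "S \<subseteq> unit_circle"
    and v: "v \<in> borel_measurable circle_borel" "\<And>z. z \<in> unit_circle - S \<Longrightarrow> v z > 0"
    and eq: "density \<mu> (indicator (- S)) = density arc_measure (\<lambda>z. ennreal (v z) * indicator (- S) z)"
  shows "emeasure \<mu>s (unit_circle - S) = 0" "AE z in arc_measure. v z = w z"
proof -
  interpret \<mu>: finite_measure \<mu> by fact
  have "sets \<mu>s = sets circle_borel" using dec by (simp add: lebesgue_decomposition_def)
  hence "space \<mu>s = unit_circle"
    using sets_eq_imp_space_eq[of \<mu>s circle_borel] by (simp add: space_restrict_space)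
  with dec obtain E where w: "w \<in> borel_measurable circle_borel" "AE z in arc_measure. 0 \<le> w z"
    and \<mu>s: "sets \<mu>s = sets circle_borel"
    and E: "E \<in> sets circle_borel" "emeasure arc_measure E = 0" "emeasure \<mu>s (unit_circle - E) = 0"
    and add: "\<And>B. B \<in> sets circle_borel \<Longrightarrow>
        emeasure \<mu> B = emeasure (density arc_measure (\<lambda>z. ennreal (w z))) B + emeasure \<mu>s B"
    unfolding lebesgue_decomposition_def mutually_singular_def by auto
  let ?U = "unit_circle - S"
  have "closed S" using S(1) by (rule finite_imp_closed)
  hence U: "?U \<in> sets circle_borel"
    by (auto simp: sets_restrict_space Diff_eq open_Compl)
  have meas: "(\<lambda>z. ennreal (f z)) \<in> borel_measurable arc_measure" if "f \<in> borel_measurable circle_borel" for f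
    unfolding measurable_cong_sets[OF sets_arc_measure refl] by (rule measurable_compose[OF that measurable_ennreal])
  have im: "(indicator (- S) :: complex \<Rightarrow> ennreal) \<in> borel_measurable circle_borel"
    by (rule measurable_restrict_space1) (use \<open>closed S\<close> in \<open>auto intro!: borel_measurable_indicator\<close>)
  have im1: "(indicator (- S) :: complex \<Rightarrow> ennreal) \<in> borel_measurable \<mu>"
    unfolding measurable_cong_sets[OF \<mu>(2) refl] by (rule im)
  have im2: "(indicator (- S) :: complex \<Rightarrow> ennreal) \<in> borel_measurable arc_measure"
    unfolding measurable_cong_sets[OF sets_arc_measure refl] by (rule im)
  have \<mu>_eq: "emeasure \<mu> (T \<inter> ?U) = (\<integral>\<^sup>+z. ennreal (v z) * indicator (- S) z * indicator T z \<partial>arc_measure)"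
    if T: "T \<in> sets circle_borel" for T
  proof -
    have sub: "T \<subseteq> unit_circle" using sets.sets_into_space[OF T] by (simp add: space_restrict_space)
    have "emeasure (density \<mu> (indicator (- S))) T = (\<integral>\<^sup>+z. indicator (- S) z * indicator T z \<partial>\<mu>)"
      by (rule emeasure_density[OF im1]) (use T \<mu>(2) in simp)
    also have "\<dots> = (\<integral>\<^sup>+z. indicator (T \<inter> ?U) z \<partial>\<mu>)"
      by (intro nn_integral_cong) (use sub in \<open>auto simp: indicator_def\<close>)
    also have "\<dots> = emeasure \<mu> (T \<inter> ?U)"
      by (rule nn_integral_indicator) (use T U \<mu>(2) in auto)
    finally have "emeasure \<mu> (T \<inter> ?U) = emeasure (density \<mu> (indicator (- S))) T" ..
    also have "\<dots> = (\<integral>\<^sup>+z. ennreal (v z) * indicator (- S) z * indicator T z \<partial>arc_measure)"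
      unfolding eq by (rule emeasure_density) (use T meas[OF v(1)] im2 in auto)
    finally show ?thesis .
  qed
  have "emeasure \<mu> (E \<inter> ?U) = 0"
  proof -
    have "AE z in arc_measure. z \<notin> E"
      using E(1,2) by (intro AE_not_in null_setsI) auto
    hence "(\<integral>\<^sup>+z. ennreal (v z) * indicator (- S) z * indicator E z \<partial>arc_measure) = (\<integral>\<^sup>+z. 0 \<partial>arc_measure)"
      by (intro nn_integral_cong_AE) (auto elim!: eventually_mono)
    thus ?thesis using \<mu>_eq[OF E(1)] by simp
  qed
  hence \<mu>sE: "emeasure \<mu>s (E \<inter> ?U) = 0"
    using add[OF sets.Int[OF E(1) U]] by simp
  have "emeasure \<mu>s ?U \<le> emeasure \<mu>s ((E \<inter> ?U) \<union> (unit_circle - E))"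
    by (intro emeasure_mono) (use E(1) U \<mu>s circle_in_sets in auto)
  also have "\<dots> \<le> emeasure \<mu>s (E \<inter> ?U) + emeasure \<mu>s (unit_circle - E)"
    by (intro emeasure_subadditive) (use E(1) U \<mu>s circle_in_sets in auto)
  finally show \<mu>sU: "emeasure \<mu>s ?U = 0" using \<mu>sE E(3) by simp
  have "AE z in arc_measure. ennreal (v z) * indicator (- S) z = ennreal (w z) * indicator (- S) z"
  proof (rule arc.density_unique2)
    show "(\<lambda>z. ennreal (v z) * indicator (- S) z) \<in> borel_measurable arc_measure"
      "(\<lambda>z. ennreal (w z) * indicator (- S) z) \<in> borel_measurable arc_measure"
      by (intro borel_measurable_times_ennreal meas v w im2)+
    fix T assume "T \<in> sets arc_measure"
    hence T: "T \<in> sets circle_borel" by simp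
    have sub: "T \<subseteq> unit_circle" using sets.sets_into_space[OF T] by (simp add: space_restrict_space)
    have TU: "T \<inter> ?U \<in> sets circle_borel" using T U by (rule sets.Int)
    have "emeasure \<mu>s (T \<inter> ?U) \<le> emeasure \<mu>s ?U" by (intro emeasure_mono) (use U \<mu>s in auto)
    hence "emeasure \<mu> (T \<inter> ?U) = emeasure (density arc_measure (\<lambda>z. ennreal (w z))) (T \<inter> ?U)"
      using add[OF TU] \<mu>sU by simp
    also have "\<dots> = (\<integral>\<^sup>+z. ennreal (w z) * indicator (T \<inter> ?U) z \<partial>arc_measure)"
      by (rule emeasure_density) (use TU meas[OF w(1)] in auto)
    also have "\<dots> = (\<integral>\<^sup>+z\<in>T. (ennreal (w z) * indicator (- S) z) \<partial>arc_measure)"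
      by (intro nn_integral_cong) (use sub in \<open>auto simp: indicator_def\<close>)
    finally show "(\<integral>\<^sup>+z\<in>T. (ennreal (v z) * indicator (- S) z) \<partial>arc_measure) =
        (\<integral>\<^sup>+z\<in>T. (ennreal (w z) * indicator (- S) z) \<partial>arc_measure)"
      unfolding \<mu>_eq[OF T] .
  qed
  moreover have "AE z in arc_measure. z \<notin> S"
    using arc_measure_null_finite[OF S] S \<open>closed S\<close>
    by (intro AE_not_in null_setsI) (auto simp: sets_restrict_space)
  moreover have "AE z in arc_measure. z \<in> unit_circle" by (rule AE_I2) simp
  ultimately show "AE z in arc_measure. v z = w z"
    using w(2)
  proof eventually_elim
    case (elim z)
    \<comment> \<open>The signs allow the return from \<open>ennreal\<close> to the reals, as
      \<open>ennreal\<close> sends all negative numbers to 0.\<close>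
    hence "ennreal (v z) = ennreal (w z)" "v z > 0" "w z \<ge> 0" using v(2)[of z] by auto
    thus ?case by (simp add: ennreal_inj)
  qed
qed

text \<open>All mass sits on the finite set \<open>S\<close>, and the points of \<open>S\<close>
  that are not atoms contribute a finite sum of zeros.\<close>

lemma continuous_part_eq_null_measure:
  assumes M: "sets M = sets circle_borel" and S: "finite S" "S \<subseteq> unit_circle"
    and null: "emeasure M (unit_circle - S) = 0"
  shows "continuous_part M = null_measure M"
proof (rule measure_eqI)
  show "sets (continuous_part M) = sets (null_measure M)" by (simp add: continuous_part_def)
  fix T assume "T \<in> sets (continuous_part M)"
  hence T: "T \<in> sets M" by (simp add: continuous_part_def)
  have sp: "space M = unit_circle"
    using sets_eq_imp_space_eq[OF M] by (simp add: space_restrict_space)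
  have fin: "R \<in> sets M" if "R \<subseteq> S" for R
    unfolding M using finite_subset[OF that S(1)] that S(2) 
    by (subst sets_restrict_space_iff) (auto intro: borel_closed finite_imp_closed)
  have U: "unit_circle - S \<in> sets M" using sets.compl_sets[OF fin[OF order_refl]] by (simp add: sp)
  let ?D = "{x \<in> space M. emeasure M {x} = 0}"
  have "emeasure M {x} = 0" if "x \<in> unit_circle - S" for x
    using emeasure_mono[of "{x}" "unit_circle - S" M] U null that by simp
  \<comment> \<open>This form also gives the measurability of \<open>?D\<close>: the circle without
    \<open>S\<close>, plus finitely many points.\<close>
  hence D: "?D = (unit_circle - S) \<union> (?D \<inter> S)" using sp S(2) by auto
  have Dm: "?D \<in> sets M" by (subst D) (intro sets.Un U fin, auto)
  have "emeasure M (?D \<inter> S) = (\<Sum>x\<in>?D \<inter> S. emeasure M {x})"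
    by (rule emeasure_eq_sum_singleton) (use S fin in auto)
  also have "\<dots> = 0" by (intro sum.neutral) auto
  finally have "emeasure M ((unit_circle - S) \<union> (?D \<inter> S)) \<le> 0"
    using emeasure_subadditive[OF U fin[of "?D \<inter> S"]] null by simp
  hence D0: "emeasure M ?D = 0" using D by simp
  have "emeasure (continuous_part M) T = (\<integral>\<^sup>+x. indicator ?D x * indicator T x \<partial>M)"
    unfolding continuous_part_def using Dm T by (intro emeasure_density) auto
  also have "\<dots> = (\<integral>\<^sup>+x. indicator (?D \<inter> T) x \<partial>M)"
    by (intro nn_integral_cong) (auto simp: indicator_def)
  also have "\<dots> = emeasure M (?D \<inter> T)" by (rule nn_integral_indicator) (use Dm T in auto)
  also have "\<dots> \<le> emeasure M ?D" by (intro emeasure_mono Dm) auto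
  finally show "emeasure (continuous_part M) T = emeasure (null_measure M) T" using D0 by simp
qed

theorem theorem1p1:
  fixes \<mu> \<mu>s :: "complex measure" and w :: "complex \<Rightarrow> real"
    and \<alpha> :: "nat \<Rightarrow> complex" and p q :: nat and A :: "real set"
  assumes "prob_space \<mu>" and "sets \<mu> = sets circle_borel"
    and "infinite (measure_support \<mu>)"
    and "lebesgue_decomposition \<mu> w \<mu>s"
    and "verblunsky_coeffs \<mu> \<alpha>"
    and "p = 2 * q + 1" and "finite A"
    and "\<alpha> \<in> ell p \<inter> GBV 0 A"
  shows "measure_support \<mu>s \<subseteq> exceptional_set q A
    \<and> continuous_part \<mu>s = null_measure \<mu>s
    \<and> (\<exists>w'. (AE z in arc_measure. w' z = w z)
          \<and> continuous_on (unit_circle - exceptional_set q A) w'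
          \<and> (\<forall>z \<in> unit_circle - exceptional_set q A. w' z > 0))"
proof -
  let ?S = "exceptional_set q A"
  obtain \<phi> where \<phi>: "orthonormal_polys \<mu> \<phi>" "\<And>n z. z \<noteq> 0 \<Longrightarrow>
          z * poly (\<phi> n) z =
            complex_of_real (sqrt (1 - (norm (\<alpha> n))\<^sup>2)) * poly (\<phi> (Suc n)) z
            + cnj (\<alpha> n) * szego_dual n (\<phi> n) z"
    and \<alpha>: "\<And>n. norm (\<alpha> n) < 1"
    using assms(5) by (auto simp: verblunsky_coeffs_def)
  interpret szego_measure \<alpha> \<phi> \<mu>
  proof (intro szego_measure.intro szego_system.intro szego_measure_axioms.intro)
    show "degree (\<phi> n) = n" for n using \<phi>(1) by (simp add: orthonormal_polys_def)
    have "Re (lead_coeff (\<phi> n)) > 0" for n using \<phi>(1) unfolding orthonormal_polys_def by blast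
    thus "\<phi> n \<noteq> 0" for n by (metis less_irrefl leading_coeff_0_iff zero_complex.sel(1))
  qed (fact \<alpha> \<phi> assms(1,2))+
  interpret \<mu>: prob_space \<mu> by fact
  obtain \<beta> where \<beta>: "gbv_system A \<beta> \<alpha> q"
    using gbv_system_exists[OF assms(7), of \<alpha> q] assms(6,8) by blast
  have S: "finite ?S" "?S \<subseteq> unit_circle"
    using finite_exceptional_set[OF assms(7)] exceptional_set_subset_circle by auto
  have \<mu>s: "sets \<mu>s = sets circle_borel" using assms(4) by (simp add: lebesgue_decomposition_def)
  have sp: "space \<mu>s = unit_circle"
    using sets_eq_imp_space_eq[OF \<mu>s] by (simp add: space_restrict_space)
  note * = lebesgue_decomposition_off_finite_set[OF \<mu>.finite_measure_axioms assms(2,4) S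
      limit_weight_measurable limit_weight_pos[OF \<beta>] density_limit_weight[OF \<beta>]]
  have "measure_support \<mu>s \<subseteq> ?S"
  proof
    fix x assume x: "x \<in> measure_support \<mu>s"
    show "x \<in> ?S"
    proof (rule ccontr)
      assume "x \<notin> ?S"
      \<comment> \<open>The complement of \<open>?S\<close> is an open set of
        \<open>\<mu>s\<close>-measure zero, so it contains no point of the support.\<close>
      moreover have "open (- ?S)" using finite_imp_closed[OF S(1)] by (rule open_Compl)
      ultimately have "emeasure \<mu>s (- ?S \<inter> space \<mu>s) > 0" using x by (auto simp: measure_support_def)
      moreover have "- ?S \<inter> space \<mu>s = unit_circle - ?S" using sp by auto
      ultimately show False using *(1) by simp
    qed
  qed
  moreover have "continuous_part \<mu>s = null_measure \<mu>s"
    by (rule continuous_part_eq_null_measure[OF \<mu>s S *(1)])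
  \<comment> \<open>The representative of \<open>w\<close> is \<open>limit_weight\<close>.\<close>
  ultimately show ?thesis
    using *(2) limit_weight_continuous[OF \<beta>] limit_weight_pos[OF \<beta>] by blast
qed

end
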